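(* Let $J=J(|x|)\geq0$ be a radial function in $L^1(\mathbb{R}^n)$ with $\chi_0=\|J\|_{L^1}=1$ such that $$\widehat{J}(\xi)=1-A|\xi|^\sigma(\ln(1/|\xi|))^\mu+o\left(|\xi|^\sigma(\ln(1/|\xi|))^\mu\right)\quad\text{as } \xi\to0,$$ where $\sigma\in(0,2]$, $\mu\in\mathbb{R}$, $A>0$. Let $u_0\in L^1(\mathbb{R}^n)$ with $\widehat{u}_0\in L^1(\mathbb{R}^n)$. Then the solution $u(t)$ of $$\partial_tu(x,t)=\int_{\mathbb{R}^n}J(x-y)u(y,t)\,dy-\chi_0u(x,t),\quad (x,t)\in\mathbb{R}^n\times(0,\infty),$$ with initial value $u_0$ satisfies $u(t)\in L^p(\mathbb{R}^n)$ for any $1\leq p\leq\infty$. Furthermore, $$\|u(t)\|_{L^p}\leq C(\|u_0\|_{L^1}+\|\widehat{u}_0\|_{L^1})(t(\ln t)^\mu)^{-\frac{n}{\sigma}(1-\frac{1}{p})}\quad\text{as } t\to\infty$$ (that is, for all sufficiently large $t$), where $C>0$ is a constant depending only on $n,J$.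
   Context: By definition, the solution of $\partial_tu=\mathcal{J}u-\chi_0u$ with initial value $u_0$, where $\mathcal{J}u=J\ast u$, is $u(t)=e^{-\chi_0t}\sum_{k=0}^\infty\frac{t^k}{k!}\mathcal{J}^ku_0$, with $\mathcal{J}^k$ the $k$-fold composition of $\mathcal{J}$. The Fourier transform is $\widehat{f}(\xi)=\int_{\mathbb{R}^n}f(x)e^{-ix\cdot\xi}\,dx$. *)

theory Defs
  imports "HOL-Probability.Essential_Supremum" "HOL-Library.Landau_Symbols"
begin

definition fourier :: "('a::euclidean_space \<Rightarrow> complex) \<Rightarrow> 'a \<Rightarrow> complex" where
  "fourier f \<xi> = (LINT x|lebesgue. f x * exp (- (\<i> * complex_of_real (x \<bullet> \<xi>))))"

definition conv_op :: "('a::euclidean_space \<Rightarrow> real) \<Rightarrow> ('a \<Rightarrow> complex) \<Rightarrow> 'a \<Rightarrow> complex" where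
  "conv_op J u x = (LINT y|lebesgue. J (x - y) *\<^sub>R u y)"

text \<open>
  The series is read pointwise. If \<open>J\<close> is integrable, and \<open>u0\<close> is integrable with integrable
  Fourier transform, then \<open>u0\<close> is essentially bounded, so all the convolution integrals exist
  and the series converges absolutely at every point.
\<close>

definition solution :: "('a::euclidean_space \<Rightarrow> real) \<Rightarrow> ('a \<Rightarrow> complex) \<Rightarrow> real \<Rightarrow> 'a \<Rightarrow> complex" where
  "solution J u0 t x =
     exp (- (LINT y|lebesgue. \<bar>J y\<bar>) * t) *\<^sub>R (\<Sum>k. (t ^ k / fact k) *\<^sub>R (conv_op J ^^ k) u0 x)"

definition in_Lp :: "ennreal \<Rightarrow> ('a::euclidean_space \<Rightarrow> complex) \<Rightarrow> bool" where
  "in_Lp p f \<longleftrightarrow> f \<in> borel_measurable lebesgue \<and>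
     (if p = \<infinity> then esssup lebesgue (\<lambda>x. ennreal (norm (f x))) < \<infinity>
      else integrable lebesgue (\<lambda>x. norm (f x) powr enn2real p))"

text \<open>Meaningful only for \<open>f\<close> satisfying \<open>in_Lp p f\<close>; otherwise the value may be a dummy.\<close>

definition Lp_norm :: "ennreal \<Rightarrow> ('a::euclidean_space \<Rightarrow> complex) \<Rightarrow> real" where
  "Lp_norm p f =
     (if p = \<infinity> then enn2real (esssup lebesgue (\<lambda>x. ennreal (norm (f x))))
      else (LINT x|lebesgue. norm (f x) powr enn2real p) powr (1 / enn2real p))"

end

theory Submission
  imports Defs "HOL-Probability.Characteristic_Functions" "HOL-Probability.Sinc_Integral"
    "HOL-Real_Asymp.Real_Asymp"
begin

text \<open>
  The solution operator is the Fourier multiplier \<open>exp (t (J^ - 1))\<close>, where \<open>J^\<close> is the Fourier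
  transform of \<open>J\<close>. Two estimates for \<open>u(t)\<close> suffice, since every \<open>L\<^sup>p\<close> norm interpolates between
  them (\<open>L1_Linf_interpolation\<close>): an \<open>L\<^sup>1\<close> bound without decay and an \<open>L\<^sup>\<infinity>\<close> bound with decay
  \<open>(t (ln t)\<^sup>\<mu>)\<^bsup>-n/\<sigma>\<^esup>\<close>. The first holds because convolution with a probability density does not
  increase the \<open>L\<^sup>1\<close> norm, so that the exponential series costs a factor \<open>e\<^sup>t\<close>, which the
  prefactor \<open>e\<^bsup>-t\<^esup>\<close> cancels (\<open>integral_norm_solution_le\<close>).

  For the second, an integrable function with integrable Fourier transform is bounded almost
  everywhere by the \<open>L\<^sup>1\<close> norm of that transform (\<open>norm_le_integral_fourier\<close>). It is obtained by
  mollifying with Gaussians, whose transforms are explicit, and testing against indicators of compact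
  sets. The same fact makes \<open>u\<^sub>0\<close> essentially bounded, so that the series defining the solution
  converges at every point.

  It remains to integrate \<open>exp (t (Re J^(\<xi>) - 1)) \<bar>u\<^sub>0^(\<xi>)\<bar>\<close> over \<open>\<xi>\<close> (\<open>fourier_solution_decay\<close>).
  Away from the origin \<open>Re J^ \<le> 1 - \<delta>\<close> (\<open>fourier_spectral_gap\<close>), which contributes the exponentially
  small amount \<open>e\<^bsup>-\<delta>t\<^esup> \<parallel>u\<^sub>0^\<parallel>\<^sub>1\<close>. Near the origin \<open>\<bar>u\<^sub>0^\<bar> \<le> \<parallel>u\<^sub>0\<parallel>\<^sub>1\<close> and the expansion of \<open>J^\<close> gives
  \<open>t (Re J^(\<xi>) - 1) \<le> - (A/2) t \<bar>\<xi>\<bar>\<^sup>\<sigma> (ln (1/\<bar>\<xi>\<bar>))\<^sup>\<mu>\<close>. With the scale \<open>s = (t (ln t)\<^sup>\<mu>)\<^bsup>1/\<sigma>\<^esup>\<close> the right-hand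
  side is at most \<open>- c (s \<bar>\<xi>\<bar>)\<^bsup>\<sigma>/2\<^esup>\<close> for large \<open>t\<close> and small \<open>\<xi>\<close> with
  \<open>s \<bar>\<xi>\<bar> \<ge> 1\<close> (\<open>scaled_symbol_lower_bound\<close>): half of
  the power is sacrificed to absorb the logarithm uniformly, which is harmless because
  \<open>exp (- c \<bar>\<eta>\<bar>\<^bsup>\<sigma>/2\<^esup>)\<close> is still integrable. Substituting \<open>\<eta> = s \<xi>\<close> produces the factor \<open>s\<^bsup>-n\<^esup>\<close>.

  The Fubini arguments are carried out for Borel functions and Borel-Lebesgue measure; Borel
  representatives of \<open>J\<close> and \<open>u\<^sub>0\<close> change the solution only on a null set (\<open>solution_AE_eq\<close>).
\<close>

section \<open>Euclidean integrals, Gaussians and the Fourier transform\<close>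

lemma cis_measurable [measurable (raw)]:
  "f \<in> borel_measurable M \<Longrightarrow> (\<lambda>x. cis (f x)) \<in> borel_measurable M"
  by (rule borel_measurable_continuous_on[OF continuous_on_cis[OF continuous_on_id]])

lemma integral_lborel_affine:
  fixes f :: "'a::euclidean_space \<Rightarrow> 'b::{banach, second_countable_topology}"
  assumes [measurable]: "f \<in> borel_measurable borel" and "c \<noteq> 0"
  shows "(LINT x|lborel. f x) = \<bar>c\<bar> ^ DIM('a) *\<^sub>R (LINT x|lborel. f (t + c *\<^sub>R x))"
  by (subst lborel_affine[OF \<open>c \<noteq> 0\<close>, of t])
     (simp add: integral_density integral_distr)

lemma integrable_lborel_affine:
  fixes f :: "'a::euclidean_space \<Rightarrow> 'b::{banach, second_countable_topology}"
  assumes "integrable lborel f" and "c \<noteq> 0"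
  shows "integrable lborel (\<lambda>x. f (t + c *\<^sub>R x))"
proof -
  have [measurable]: "f \<in> borel_measurable borel"
    using assms(1) by (auto dest: borel_measurable_integrable)
  have "integrable (density (distr lborel borel (\<lambda>x. t + c *\<^sub>R x)) (\<lambda>_. \<bar>c\<bar>^DIM('a))) f"
    using assms(1) lborel_affine[OF \<open>c \<noteq> 0\<close>, of t] by simp
  then have "integrable lborel (\<lambda>x. \<bar>c\<bar> ^ DIM('a) *\<^sub>R f (t + c *\<^sub>R x))"
    by (simp add: integrable_density integrable_distr_eq)
  from integrable_scaleR_right[OF this, of "inverse (\<bar>c\<bar> ^ DIM('a))"] show ?thesis
    using \<open>c \<noteq> 0\<close> by simp
qed

text \<open>
  Lebesgue measure is the image of the product measure over the coordinates, so integrals of products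
  of one-variable functions factor.
\<close>
lemma integral_prod_Basis:
  fixes f :: "'a::euclidean_space \<Rightarrow> real \<Rightarrow> 'b::{real_normed_field,banach,second_countable_topology}"
  assumes f: "\<And>b. b \<in> Basis \<Longrightarrow> integrable lborel (f b)"
  shows "integrable lborel (\<lambda>x::'a. \<Prod>b\<in>Basis. f b (x \<bullet> b))"
    and "(LINT x|(lborel :: 'a measure). (\<Prod>b\<in>Basis. f b (x \<bullet> b))) = (\<Prod>b\<in>Basis. integral\<^sup>L lborel (f b))"
proof -
  interpret product_sigma_finite "\<lambda>_::'a. lborel :: real measure" ..
  have [measurable]: "f b \<in> borel_measurable borel" if "b \<in> Basis" for b
    using f[OF that] by (auto dest: borel_measurable_integrable)
  have eq: "(\<Prod>b\<in>Basis. f b ((\<Sum>b'\<in>Basis. y b' *\<^sub>R b') \<bullet> b)) = (\<Prod>b\<in>Basis. f b (y b))" for y :: "'a \<Rightarrow> real"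
    by (intro prod.cong refl) simp
  have [measurable]: "(\<lambda>y. \<Sum>b\<in>Basis. y b *\<^sub>R b) \<in> (\<Pi>\<^sub>M b\<in>Basis. lborel) \<rightarrow>\<^sub>M (borel :: 'a measure)"
    by measurable
  show "integrable lborel (\<lambda>x::'a. \<Prod>b\<in>Basis. f b (x \<bullet> b))"
    unfolding lborel_eq[where 'a='a]
    by (subst integrable_distr_eq) (auto simp: eq intro!: product_integrable_prod f)
  show "(LINT x|(lborel :: 'a measure). (\<Prod>b\<in>Basis. f b (x \<bullet> b))) = (\<Prod>b\<in>Basis. integral\<^sup>L lborel (f b))"
    unfolding lborel_eq[where 'a='a]
    by (subst integral_distr) (auto simp: eq intro!: product_integral_prod f)
qed

definition gaussian :: "'a::euclidean_space \<Rightarrow> real" where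
  "gaussian x = (\<Prod>b\<in>Basis. std_normal_density (x \<bullet> b))"

lemma gaussian_measurable [measurable]: "gaussian \<in> borel_measurable borel"
  unfolding gaussian_def by measurable

lemma gaussian_nonneg [simp]: "0 \<le> gaussian x"
  by (simp add: gaussian_def prod_nonneg)

lemma gaussian_le_1: "gaussian x \<le> 1"
proof -
  have "std_normal_density y \<le> 1" for y
  proof -
    have "1 / sqrt (2 * pi) * exp (- y\<^sup>2 / 2) \<le> 1 * 1"
      using pi_gt3 by (intro mult_mono) (auto simp: field_simps real_le_rsqrt)
    then show ?thesis by (simp add: std_normal_density_def)
  qed
  then show ?thesis unfolding gaussian_def by (intro prod_le_1) auto
qed

lemma integrable_gaussian: "integrable lborel gaussian"
  unfolding gaussian_def[abs_def] by (rule integral_prod_Basis(1)) simp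

lemma integral_gaussian: "(LINT x|lborel. gaussian x) = 1"
  unfolding gaussian_def[abs_def] by (subst integral_prod_Basis(2)) auto

lemma char_std_normal_density:
  "(LINT x|lborel. std_normal_density x *\<^sub>R cis (s * x)) = of_real (exp (- s\<^sup>2 / 2))"
  using fun_cong[OF char_std_normal_distribution, of s]
  unfolding char_def by (simp add: integral_density cis_conv_exp)

text \<open>
  Coordinatewise this is the characteristic function of the normal distribution. Writing the Gaussian
  as a product of one-dimensional densities makes the transform a constant multiple of the Gaussian itself.
\<close>
lemma gaussian_self_dual:
  fixes \<xi> :: "'a::euclidean_space"
  shows "(LINT x|lborel. gaussian x *\<^sub>R cis (\<xi> \<bullet> x)) = of_real (sqrt (2 * pi) ^ DIM('a) * gaussian \<xi>)"
proof -
  have eq: "gaussian x *\<^sub>R cis (\<xi> \<bullet> x) = (\<Prod>b\<in>Basis. std_normal_density (x \<bullet> b) *\<^sub>R cis ((\<xi> \<bullet> b) * (x \<bullet> b)))" for x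
    by (subst euclidean_inner)
       (simp add: gaussian_def cis_conv_exp scaleR_conv_of_real prod.distrib sum_distrib_left exp_sum)
  have int: "integrable lborel (\<lambda>x. std_normal_density x *\<^sub>R cis (s * x))" for s
    by (rule Bochner_Integration.integrable_bound[of _ std_normal_density]) auto
  have "(LINT x|lborel. gaussian x *\<^sub>R cis (\<xi> \<bullet> x)) = (\<Prod>b\<in>Basis. of_real (exp (- (\<xi> \<bullet> b)\<^sup>2 / 2)))"
    unfolding eq using int by (subst integral_prod_Basis(2)) (auto simp only: char_std_normal_density)
  also have "\<dots> = of_real (\<Prod>b\<in>(Basis::'a set). sqrt (2 * pi) * std_normal_density (\<xi> \<bullet> b))"
    by (simp add: std_normal_density_def)
  also have "\<dots> = of_real (sqrt (2 * pi) ^ DIM('a) * gaussian \<xi>)"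
    by (simp only: prod.distrib gaussian_def prod_constant)
  finally show ?thesis .
qed

lemma fourier_borel:
  assumes [measurable]: "f \<in> borel_measurable borel"
  shows "fourier f \<xi> = (LINT x|lborel. f x * cis (- (x \<bullet> \<xi>)))"
proof -
  have "fourier f \<xi> = (LINT x|lebesgue. f x * cis (- (x \<bullet> \<xi>)))"
    unfolding fourier_def cis_conv_exp by simp
  also have "\<dots> = (LINT x|lborel. f x * cis (- (x \<bullet> \<xi>)))"
    by (rule integral_completion) measurable
  finally show ?thesis .
qed

lemma fourier_measurable [measurable]:
  assumes [measurable]: "f \<in> borel_measurable borel"
  shows "fourier f \<in> borel_measurable borel"
  unfolding fourier_borel[OF assms, abs_def] by measurable

lemma norm_fourier_le:
  assumes "f \<in> borel_measurable borel"
  shows "norm (fourier f \<xi>) \<le> (LINT x|lborel. norm (f x))"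
  unfolding fourier_borel[OF assms]
  by (rule order_trans[OF integral_norm_bound]) (simp add: norm_mult)

section \<open>Mollification by Gaussians\<close>

lemma integrable_lborel_pair_bound:
  fixes h :: "'a::euclidean_space \<times> 'b::euclidean_space \<Rightarrow> 'c::{banach, second_countable_topology}"
    and a :: "'a \<Rightarrow> real" and b :: "'b \<Rightarrow> real"
  assumes [measurable]: "h \<in> borel_measurable (lborel \<Otimes>\<^sub>M lborel)"
    and a: "integrable lborel a" and b: "integrable lborel b"
    and le: "\<And>x y. norm (h (x, y)) \<le> a x * b y"
  shows "integrable (lborel \<Otimes>\<^sub>M lborel) h"
proof -
  have [measurable]: "a \<in> borel_measurable borel" "b \<in> borel_measurable borel"
    using a b by (auto dest: borel_measurable_integrable)
  have "integrable (lborel \<Otimes>\<^sub>M lborel) (\<lambda>(x, y). a x * b y)"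
  proof (rule lborel_pair.Fubini_integrable)
    have "(\<lambda>x. LINT y|lborel. norm (case (x, y) of (x, y) \<Rightarrow> a x * b y)) = (\<lambda>x. \<bar>a x\<bar> * (LINT y|lborel. \<bar>b y\<bar>))"
      by (simp add: abs_mult)
    then show "integrable lborel (\<lambda>x. LINT y|lborel. norm (case (x, y) of (x, y) \<Rightarrow> a x * b y))"
      using a by simp
  qed (use b in auto)
  then show ?thesis
    by (rule Bochner_Integration.integrable_bound)
       (auto intro!: AE_I2 order_trans[OF le] abs_ge_self)
qed

text \<open>
  A Gaussian average of \<open>u\<close> can be written in terms of \<open>fourier u\<close>: express the Gaussian as a Fourier
  integral of itself and exchange the integrals. The Gaussian factor left on the Fourier side is
  at most 1, so the bound is uniform in the point \<open>y\<close> and in the scale \<open>c\<close>.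
\<close>
lemma norm_mollified_le:
  fixes u :: "'a::euclidean_space \<Rightarrow> complex"
  assumes u: "integrable lborel u" and fu: "integrable lborel (fourier u)" and c: "c \<noteq> 0"
  shows "norm (LINT z|lborel. gaussian z *\<^sub>R u (y + c *\<^sub>R z)) \<le> (LINT \<xi>|lborel. norm (fourier u \<xi>))"
proof -
  have [measurable]: "u \<in> borel_measurable borel"
    using u by (auto dest: borel_measurable_integrable)
  define G where "G = sqrt (2 * pi) ^ DIM('a)"
  have G: "G \<ge> 1"
    unfolding G_def using pi_gt3 by (intro one_le_power) (auto simp: real_le_rsqrt)
  define U where "U = (LINT z|lborel. gaussian z *\<^sub>R u (y + c *\<^sub>R z))"
  \<comment> \<open>The double integrand after replacing the Gaussian weight by its Fourier integral.\<close>
  define h where "h x \<eta> = (gaussian \<eta> *\<^sub>R cis (((1 / c) *\<^sub>R (x - y)) \<bullet> \<eta>)) * u x" for x \<eta>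
  have "(\<bar>c\<bar> ^ DIM('a) * G) *\<^sub>R U = G *\<^sub>R (LINT x|lborel. gaussian ((1 / c) *\<^sub>R (x - y)) *\<^sub>R u x)"
    using c by (subst integral_lborel_affine[of _ c y]) (simp_all add: U_def)
  also have "\<dots> = (LINT x|lborel. of_real (G * gaussian ((1 / c) *\<^sub>R (x - y))) * u x)"
    by (simp add: scaleR_conv_of_real mult.assoc)
  also have "\<dots> = (LINT x|lborel. (LINT \<eta>|lborel. h x \<eta>))"
    unfolding G_def gaussian_self_dual[symmetric] h_def by (simp only: integral_mult_left_zero)
  also have "\<dots> = (LINT \<eta>|lborel. (LINT x|lborel. h x \<eta>))"
  proof (rule lborel_pair.Fubini_integral[symmetric])
    show "integrable (lborel \<Otimes>\<^sub>M lborel) (\<lambda>(x, \<eta>). h x \<eta>)"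
      by (rule integrable_lborel_pair_bound[OF _ integrable_norm[OF u] integrable_gaussian])
         (auto simp: h_def norm_mult)
  qed
  also have "\<dots> = (LINT \<eta>|lborel. (gaussian \<eta> *\<^sub>R cis (- (((1 / c) *\<^sub>R y) \<bullet> \<eta>))) * fourier u (0 + (- 1 / c) *\<^sub>R \<eta>))"
  proof (rule Bochner_Integration.integral_cong[OF refl])
    fix \<eta> :: 'a
    have "h x \<eta> = (gaussian \<eta> *\<^sub>R cis (- (((1 / c) *\<^sub>R y) \<bullet> \<eta>))) * (u x * cis (- (x \<bullet> (0 + (- 1 / c) *\<^sub>R \<eta>))))" for x
      using cis_mult[of "- (((1 / c) *\<^sub>R y) \<bullet> \<eta>)" "- (x \<bullet> (0 + (- 1 / c) *\<^sub>R \<eta>))", symmetric]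
      by (simp add: h_def inner_diff_left diff_divide_distrib)
    then show "(LINT x|lborel. h x \<eta>) = (gaussian \<eta> *\<^sub>R cis (- (((1 / c) *\<^sub>R y) \<bullet> \<eta>))) * fourier u (0 + (- 1 / c) *\<^sub>R \<eta>)"
      by (simp add: fourier_borel)
  qed
  finally have eq: "(\<bar>c\<bar> ^ DIM('a) * G) *\<^sub>R U = \<dots>" .
  have int: "integrable lborel (\<lambda>\<eta>. norm (fourier u (0 + (- 1 / c) *\<^sub>R \<eta>)))"
    using c by (intro integrable_norm integrable_lborel_affine fu) simp
  have "\<bar>c\<bar> ^ DIM('a) * G * norm U = norm ((\<bar>c\<bar> ^ DIM('a) * G) *\<^sub>R U)"
    using G by (simp add: power_abs)
  also have "\<dots> \<le> (LINT \<eta>|lborel. norm ((gaussian \<eta> *\<^sub>R cis (- (((1 / c) *\<^sub>R y) \<bullet> \<eta>))) * fourier u (0 + (- 1 / c) *\<^sub>R \<eta>)))"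
    unfolding eq by (rule integral_norm_bound)
  also have "\<dots> \<le> (LINT \<eta>|lborel. norm (fourier u (0 + (- 1 / c) *\<^sub>R \<eta>)))"
    by (rule integral_mono'[OF int])
       (auto simp: norm_mult intro!: mult_left_le_one_le gaussian_le_1)
  also have "\<dots> = \<bar>c\<bar> ^ DIM('a) * (LINT \<xi>|lborel. norm (fourier u \<xi>))"
    using c integral_lborel_affine[of "\<lambda>\<xi>. norm (fourier u \<xi>)" "- 1 / c" 0]
    by (simp add: power_divide field_simps)
  finally have "G * norm U \<le> (LINT \<xi>|lborel. norm (fourier u \<xi>))"
    using c by (simp add: mult.assoc)
  moreover have "norm U \<le> G * norm U"
    using G by (simp add: mult_le_cancel_right1)
  ultimately show ?thesis by (simp add: U_def)
qed

text \<open>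
  Pair the Gaussian averages of \<open>u\<close> with \<open>\<phi>\<close> and let the scale tend to 0. Moving the shift onto the
  continuous function \<open>\<phi>\<close> makes dominated convergence applicable although \<open>u\<close> is only integrable.
\<close>
lemma norm_integral_test_function_le:
  fixes u :: "'a::euclidean_space \<Rightarrow> complex" and \<phi> :: "'a \<Rightarrow> real"
  assumes u: "integrable lborel u" and fu: "integrable lborel (fourier u)"
    and \<phi>: "continuous_on UNIV \<phi>" "\<And>x. 0 \<le> \<phi> x" "\<And>x. \<phi> x \<le> 1" "integrable lborel \<phi>"
  shows "norm (LINT x|lborel. \<phi> x *\<^sub>R u x)
     \<le> (LINT \<xi>|lborel. norm (fourier u \<xi>)) * (LINT x|lborel. \<phi> x)"
proof -
  have [measurable]: "u \<in> borel_measurable borel" "\<phi> \<in> borel_measurable borel"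
    using u \<phi> by (auto dest: borel_measurable_integrable)
  define K where "K = (LINT \<xi>|lborel. norm (fourier u \<xi>))"
  \<comment> \<open>The pairing of \<open>\<phi>\<close> with the translate of \<open>u\<close> by \<open>c z\<close>, with the shift moved onto \<open>\<phi>\<close>.\<close>
  define H where "H c z = (LINT x|lborel. \<phi> (x - c *\<^sub>R z) *\<^sub>R u x)" for c z
  have Hm [measurable]: "H c \<in> borel_measurable borel" for c
    unfolding H_def by measurable
  have Hle: "norm (H c z) \<le> (LINT x|lborel. norm (u x))" for c z
    unfolding H_def
    by (rule order_trans[OF integral_norm_bound], rule integral_mono')
       (use u \<phi> in \<open>auto intro!: mult_left_le_one_le\<close>)
  define c where "c k = 1 / real (Suc k)" for k
  have c: "c \<longlonglongrightarrow> 0" "c k \<noteq> 0" for k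
    unfolding c_def by real_asymp auto
  have bound: "norm (LINT z|lborel. gaussian z *\<^sub>R H (c k) z) \<le> K * (LINT x|lborel. \<phi> x)" for k
  proof -
    have swap: "integrable (lborel \<Otimes>\<^sub>M lborel) (\<lambda>(z, y). (\<phi> y * gaussian z) *\<^sub>R u (y + c k *\<^sub>R z))"
    proof (rule lborel_pair.Fubini_integrable)
      have int: "integrable lborel (\<lambda>y. u (y + d))" for d
        using integrable_lborel_affine[OF u, of 1 d] by (simp add: add.commute)
      show "AE z in lborel. integrable lborel (\<lambda>y. case (z, y) of (z, y) \<Rightarrow> (\<phi> y * gaussian z) *\<^sub>R u (y + c k *\<^sub>R z))"
      proof (rule AE_I2)
        fix z
        show "integrable lborel (\<lambda>y. case (z, y) of (z, y) \<Rightarrow> (\<phi> y * gaussian z) *\<^sub>R u (y + c k *\<^sub>R z))"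
          by (rule Bochner_Integration.integrable_bound[OF int[of "c k *\<^sub>R z"]])
             (use \<phi> gaussian_le_1 in \<open>auto intro!: AE_I2 mult_left_le_one_le mult_le_one\<close>)
      qed
      show "integrable lborel (\<lambda>z. LINT y|lborel. norm (case (z, y) of (z, y) \<Rightarrow> (\<phi> y * gaussian z) *\<^sub>R u (y + c k *\<^sub>R z)))"
      proof (rule Bochner_Integration.integrable_bound)
        show "integrable lborel (\<lambda>z. gaussian z * (LINT x|lborel. norm (u x)))"
          by (intro integrable_mult_left integrable_gaussian)
        show "AE z in lborel. norm (LINT y|lborel. norm (case (z, y) of (z, y) \<Rightarrow> (\<phi> y * gaussian z) *\<^sub>R u (y + c k *\<^sub>R z)))
            \<le> norm (gaussian z * (LINT x|lborel. norm (u x)))"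
        proof (rule AE_I2)
          fix z
          have "(LINT y|lborel. norm ((\<phi> y * gaussian z) *\<^sub>R u (y + c k *\<^sub>R z))) \<le> (LINT y|lborel. gaussian z * norm (u (y + c k *\<^sub>R z)))"
            by (rule integral_mono')
               (use \<phi> int[of "c k *\<^sub>R z"] in \<open>auto simp: abs_mult mult.assoc intro!: mult_left_le_one_le\<close>)
          also have "\<dots> = gaussian z * (LINT x|lborel. norm (u x))"
            using integral_lborel_affine[of "\<lambda>x. norm (u x)" 1 "c k *\<^sub>R z"] by (simp add: add.commute)
          finally show "norm (LINT y|lborel. norm (case (z, y) of (z, y) \<Rightarrow> (\<phi> y * gaussian z) *\<^sub>R u (y + c k *\<^sub>R z)))
            \<le> norm (gaussian z * (LINT x|lborel. norm (u x)))"
            by (simp add: abs_mult)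
        qed
      qed measurable
    qed measurable
    have "gaussian z *\<^sub>R H (c k) z = (LINT y|lborel. (\<phi> y * gaussian z) *\<^sub>R u (y + c k *\<^sub>R z))" for z
    proof -
      have "H (c k) z = (LINT y|lborel. \<phi> y *\<^sub>R u (y + c k *\<^sub>R z))"
        unfolding H_def
        by (subst integral_lborel_affine[of _ 1 "c k *\<^sub>R z"]) (simp_all add: add.commute)
      then show ?thesis
        by (simp flip: integral_scaleR_right add: mult.commute)
    qed
    then have "(LINT z|lborel. gaussian z *\<^sub>R H (c k) z) = (LINT z|lborel. LINT y|lborel. (\<phi> y * gaussian z) *\<^sub>R u (y + c k *\<^sub>R z))"
      by simp
    also have "\<dots> = (LINT y|lborel. \<phi> y *\<^sub>R (LINT z|lborel. gaussian z *\<^sub>R u (y + c k *\<^sub>R z)))"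
      by (subst lborel_pair.Fubini_integral[OF swap, symmetric]) (simp flip: scaleR_scaleR)
    also have "norm \<dots> \<le> (LINT y|lborel. norm (\<phi> y *\<^sub>R (LINT z|lborel. gaussian z *\<^sub>R u (y + c k *\<^sub>R z))))"
      by (rule integral_norm_bound)
    also have "\<dots> \<le> (LINT y|lborel. \<phi> y * K)"
      by (rule integral_mono')
         (use \<phi> norm_mollified_le[OF u fu c(2)] in \<open>auto simp: K_def intro!: mult_left_mono\<close>)
    finally show ?thesis by (simp add: mult.commute)
  qed
  have "(\<lambda>k. LINT z|lborel. gaussian z *\<^sub>R H (c k) z) \<longlonglongrightarrow> (LINT z|(lborel :: 'a measure). gaussian z *\<^sub>R (LINT x|lborel. \<phi> x *\<^sub>R u x))"
  proof (rule integral_dominated_convergence)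
    show "integrable lborel (\<lambda>z. gaussian z * (LINT x|lborel. norm (u x)))"
      by (intro integrable_mult_left integrable_gaussian)
    show "AE z in lborel. (\<lambda>k. gaussian z *\<^sub>R H (c k) z) \<longlonglongrightarrow> gaussian z *\<^sub>R (LINT x|lborel. \<phi> x *\<^sub>R u x)"
    proof (intro AE_I2 tendsto_intros)
      fix z
      show "(\<lambda>k. H (c k) z) \<longlonglongrightarrow> (LINT x|lborel. \<phi> x *\<^sub>R u x)"
        unfolding H_def
      proof (rule integral_dominated_convergence[OF _ _ integrable_norm[OF u]])
        show "AE x in lborel. (\<lambda>k. \<phi> (x - c k *\<^sub>R z) *\<^sub>R u x) \<longlonglongrightarrow> \<phi> x *\<^sub>R u x"
        proof (intro AE_I2 tendsto_intros)
          fix x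
          have "(\<lambda>k. x - c k *\<^sub>R z) \<longlonglongrightarrow> x - 0 *\<^sub>R z"
            by (intro tendsto_intros c)
          then show "(\<lambda>k. \<phi> (x - c k *\<^sub>R z)) \<longlonglongrightarrow> \<phi> x"
            using \<phi>(1) isCont_tendsto_compose[of x \<phi>] by (simp add: continuous_on_eq_continuous_at)
        qed
        show "AE x in lborel. norm (\<phi> (x - c k *\<^sub>R z) *\<^sub>R u x) \<le> norm (u x)" for k
          using \<phi> by (auto intro!: mult_left_le_one_le)
      qed measurable
    qed
    show "AE z in lborel. norm (gaussian z *\<^sub>R H (c k) z) \<le> gaussian z * (LINT x|lborel. norm (u x))" for k
      using Hle by (auto intro!: mult_left_mono)
  qed measurable
  also have "(LINT z|(lborel :: 'a measure). gaussian z *\<^sub>R (LINT x|lborel. \<phi> x *\<^sub>R u x)) = (LINT x|lborel. \<phi> x *\<^sub>R u x)"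
    by (simp add: integral_gaussian integrable_gaussian)
  finally show ?thesis
    using bound unfolding K_def by (intro LIMSEQ_le_const2[OF tendsto_norm]) auto
qed

section \<open>An integrable Fourier transform bounds the function\<close>

lemma integrable_indicator_compact:
  "compact K \<Longrightarrow> integrable lborel (indicator K :: 'a::euclidean_space \<Rightarrow> real)"
  using emeasure_compact_finite[of K]
  by (simp add: integrable_indicator_iff borel_compact)

text \<open>
  Inner regularity, preceded by a restriction to a ball so that measures are finite and closed sets compact.
\<close>
lemma compact_subset_of_nonnull:
  fixes E :: "'a::euclidean_space set"
  assumes E: "E \<in> sets borel" "emeasure lborel E \<noteq> 0"
  obtains K where "compact K" "K \<subseteq> E" "0 < measure lborel K"
proof -
  have "\<exists>k. emeasure lborel (E \<inter> cball 0 (real k)) \<noteq> 0"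
  proof (rule ccontr)
    assume "\<not> ?thesis"
    then have "(\<Union>k. E \<inter> cball 0 (real k)) \<in> null_sets lborel"
      using E by (intro null_sets_UN) (auto simp: null_sets_def)
    moreover have "(\<Union>k. E \<inter> cball 0 (real k)) = E"
      using real_arch_simple by auto
    ultimately show False
      using E by (simp add: null_sets_def)
  qed
  then obtain k where k: "emeasure lborel (E \<inter> cball 0 (real k)) \<noteq> 0" ..
  define B where "B = E \<inter> cball 0 (real k)"
  have B: "B \<in> sets borel" using E by (simp add: B_def)
  have fin: "emeasure lborel B < \<infinity>"
    using emeasure_mono[of B "cball 0 (real k)" lborel] emeasure_lborel_cball_finite[of "0::'a" "real k"]
    by (simp add: B_def order_le_less_trans)
  have pos: "0 < measure lborel B"
    using k fin by (simp add: B_def measure_def enn2real_positive_iff zero_less_iff_neq_zero)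
  obtain T where T: "closed T" "T \<subseteq> B" "emeasure lebesgue (B - T) < ennreal (measure lborel B)"
    by (rule sets_lebesgue_inner_closed[of B "measure lborel B"])
       (use B pos in \<open>auto intro: sets_completionI_sets\<close>)
  have "emeasure lborel (B - T) < ennreal (measure lborel B)"
    using T B by (simp add: borel_closed)
  moreover have "emeasure lborel T = 0 \<Longrightarrow> emeasure lborel (B - T) = emeasure lborel B"
    using T B by (intro emeasure_Diff_null_set) (auto simp: null_sets_def borel_closed)
  moreover have "emeasure lborel B = ennreal (measure lborel B)"
    using fin by (simp add: emeasure_eq_ennreal_measure)
  ultimately have "emeasure lborel T \<noteq> 0"
    by auto
  moreover have "compact T"
    using T compact_Int_closed[of "cball 0 (real k)" T] by (simp add: B_def Int_absorb1)
  ultimately show thesis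
    using T emeasure_compact_finite[of T]
    by (intro that[of T]) (auto simp: B_def measure_def enn2real_positive_iff zero_less_iff_neq_zero)
qed

text \<open>
  The indicator of a compact set is a decreasing limit of continuous functions, cut off by the
  distance to the set.
\<close>
lemma norm_integral_compact_le:
  fixes u :: "'a::euclidean_space \<Rightarrow> complex"
  assumes u: "integrable lborel u" and fu: "integrable lborel (fourier u)" and K: "compact K"
  shows "norm (LINT x|lborel. indicator K x *\<^sub>R u x)
     \<le> (LINT \<xi>|lborel. norm (fourier u \<xi>)) * measure lborel K"
proof (cases "K = {}")
  case False
  have [measurable]: "u \<in> borel_measurable borel" "K \<in> sets borel"
    using u K by (auto dest: borel_measurable_integrable simp: borel_compact)
  define \<phi> where "\<phi> k x = max 0 (1 - real (Suc k) * infdist x K)" for k x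
  have cont: "continuous_on UNIV (\<phi> k)" for k
    unfolding \<phi>_def by (intro continuous_intros)
  have [measurable]: "\<phi> k \<in> borel_measurable borel" for k
    by (rule borel_measurable_continuous_onI[OF cont])
  have nonneg: "0 \<le> \<phi> k x" and le1: "\<phi> k x \<le> 1" for k x
    by (auto simp: \<phi>_def infdist_nonneg)
  \<comment> \<open>A compact set that contains the supports of all cut-offs and provides the dominating function.\<close>
  define L where "L = {x. infdist x K \<le> 1}"
  have L: "compact L"
    unfolding L_def using K False by (intro compact_infdist_le) auto
  have leL: "\<phi> k x \<le> indicator L x" for k x
  proof (cases "x \<in> L")
    case False
    then have "1 * 1 \<le> real (Suc k) * infdist x K"
      by (intro mult_mono) (auto simp: L_def)
    then show ?thesis using False by (simp add: \<phi>_def)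
  qed (use le1 in simp)
  have int: "integrable lborel (\<phi> k)" for k
    by (rule Bochner_Integration.integrable_bound[OF integrable_indicator_compact[OF L]])
       (use nonneg leL in auto)
  have lim: "(\<lambda>k. \<phi> k x) \<longlonglongrightarrow> indicator K x" for x
  proof (cases "x \<in> K")
    case True
    then show ?thesis by (simp add: \<phi>_def)
  next
    case False
    then have "0 < infdist x K"
      using K \<open>K \<noteq> {}\<close> by (metis compact_imp_closed in_closed_iff_infdist_zero infdist_nonneg order_le_less)
    then have "(\<lambda>k. max 0 (1 - real (Suc k) * infdist x K)) \<longlonglongrightarrow> 0"
      by real_asymp
    then show ?thesis using False by (simp add: \<phi>_def)
  qed
  have 1: "(\<lambda>k. LINT x|lborel. \<phi> k x *\<^sub>R u x) \<longlonglongrightarrow> (LINT x|lborel. indicator K x *\<^sub>R u x)"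
  proof (rule integral_dominated_convergence[OF _ _ integrable_norm[OF u]])
    show "AE x in lborel. (\<lambda>k. \<phi> k x *\<^sub>R u x) \<longlonglongrightarrow> indicator K x *\<^sub>R u x"
      by (intro AE_I2 tendsto_intros lim)
  qed (use nonneg le1 in \<open>auto intro!: mult_left_le_one_le\<close>)
  have "(\<lambda>k. LINT x|lborel. \<phi> k x) \<longlonglongrightarrow> (LINT x|lborel. indicator K x)"
    by (rule integral_dominated_convergence[OF _ _ integrable_indicator_compact[OF L]])
       (use nonneg leL lim in auto)
  then have 2: "(\<lambda>k. LINT x|lborel. \<phi> k x) \<longlonglongrightarrow> measure lborel K"
    by simp
  show ?thesis
    by (rule LIMSEQ_le[OF tendsto_norm[OF 1] tendsto_mult[OF tendsto_const 2]])
       (use norm_integral_test_function_le[OF u fu cont nonneg le1 int] in auto)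
qed simp

text \<open>
  If \<open>\<bar>u\<bar>\<close> exceeded the bound on a set of positive measure, then \<open>u\<close> would be close to a single
  number \<open>w\<close> of too large modulus on a set of positive measure, because countably many such \<open>w\<close> suffice.
  The average of \<open>u\<close> over a compact subset would then violate the bound for compact sets.
\<close>
theorem norm_le_integral_fourier:
  fixes u :: "'a::euclidean_space \<Rightarrow> complex"
  assumes u: "integrable lborel u" and fu: "integrable lborel (fourier u)"
  shows "AE x in lborel. norm (u x) \<le> (LINT \<xi>|lborel. norm (fourier u \<xi>))"
proof -
  have [measurable]: "u \<in> borel_measurable borel"
    using u by (auto dest: borel_measurable_integrable)
  define B where "B = (LINT \<xi>|lborel. norm (fourier u \<xi>))"
  obtain D :: "complex set" where D: "countable D" "\<And>X. open X \<Longrightarrow> X \<noteq> {} \<Longrightarrow> \<exists>d\<in>D. d \<in> X"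
    by (rule countable_dense_setE) auto
  \<comment> \<open>On \<open>E w\<close> the function stays within half of the excess of \<open>norm w\<close> over the bound.\<close>
  define E where "E w = {x. norm (u x - w) < (norm w - B) / 2}" for w
  have E [measurable]: "E w \<in> sets borel" for w
    unfolding E_def by measurable
  have "E w \<in> null_sets lborel" for w
  proof (rule ccontr)
    assume "E w \<notin> null_sets lborel"
    then obtain K where K: "compact K" "K \<subseteq> E w" "0 < measure lborel K"
      using compact_subset_of_nonnull[of "E w"] by (auto simp: null_sets_def)
    then obtain x where "x \<in> E w" by (cases "K = {}") auto
    then have w: "B < norm w"
      using order_le_less_trans[OF norm_ge_zero, of "u x - w" "(norm w - B) / 2"] by (simp add: E_def)
    have [measurable]: "K \<in> sets borel" using K by (simp add: borel_compact)
    define m where "m = measure lborel K"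
    have iK: "integrable lborel (\<lambda>x. indicator K x *\<^sub>R c)" for c :: "'b::{banach, second_countable_topology}"
      using integrable_indicator_compact[OF K(1)] by (rule integrable_scaleR_left)
    have iu: "integrable lborel (\<lambda>x. indicator K x *\<^sub>R u x)"
      by (rule Bochner_Integration.integrable_bound[OF u]) (auto simp: indicator_def)
    have "(LINT x|lborel. indicator K x *\<^sub>R u x) - (LINT x|lborel. indicator K x *\<^sub>R w)
        = (LINT x|lborel. indicator K x *\<^sub>R (u x - w))"
      by (subst Bochner_Integration.integral_diff[symmetric, OF iu iK]) (simp add: scaleR_diff_right)
    also have "norm \<dots> \<le> (LINT x|lborel. norm (indicator K x *\<^sub>R (u x - w)))"
      by (rule integral_norm_bound)
    also have "\<dots> \<le> (LINT x|lborel. indicator K x *\<^sub>R ((norm w - B) / 2))"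
      by (rule integral_mono'[OF iK]) (use K w in \<open>auto simp: E_def indicator_def\<close>)
    also have "\<dots> = m * ((norm w - B) / 2)"
      using integrable_indicator_compact[OF K(1)] by (simp add: m_def)
    finally have "norm ((LINT x|lborel. indicator K x *\<^sub>R u x) - m *\<^sub>R w) \<le> m * ((norm w - B) / 2)"
      using integrable_indicator_compact[OF K(1)] by (simp add: m_def)
    moreover have "norm (LINT x|lborel. indicator K x *\<^sub>R u x) \<le> B * m"
      using norm_integral_compact_le[OF u fu K(1)] by (simp add: B_def m_def)
    moreover have "norm (m *\<^sub>R w) \<le> norm (LINT x|lborel. indicator K x *\<^sub>R u x)
        + norm ((LINT x|lborel. indicator K x *\<^sub>R u x) - m *\<^sub>R w)"
      by (metis norm_minus_commute norm_triangle_sub)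
    ultimately have "m * norm w \<le> B * m + m * ((norm w - B) / 2)"
      by (simp add: m_def)
    then have "m * norm w \<le> m * B"
      by (simp add: field_simps)
    then show False using w K by (simp add: m_def)
  qed
  then have "(\<Union>w\<in>D. E w) \<in> null_sets lborel"
    using D(1) by (intro null_sets_UN') auto
  moreover have "{x \<in> space lborel. \<not> norm (u x) \<le> B} \<subseteq> (\<Union>w\<in>D. E w)"
  proof safe
    fix x assume "\<not> norm (u x) \<le> B"
    then have "ball (u x) ((norm (u x) - B) / 4) \<noteq> {}" by simp
    then obtain w where w: "w \<in> D" "norm (u x - w) < (norm (u x) - B) / 4"
      using D(2)[of "ball (u x) ((norm (u x) - B) / 4)"] by (auto simp: dist_norm)
    then have "x \<in> E w"
      unfolding E_def mem_Collect_eq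
      using norm_triangle_ineq2[of "u x" w] norm_ge_zero[of "u x - w"] w(2) by argo
    then show "x \<in> (\<Union>w\<in>D. E w)" using w by auto
  qed
  ultimately show ?thesis
    unfolding B_def by (rule AE_I')
qed

section \<open>The spectral gap away from the origin\<close>

text \<open>
  A quantitative Riemann-Lebesgue lemma. Translation by the vector \<open>h\<close> in direction \<open>\<xi>\<close> with
  \<open>h \<bullet> \<xi> = \<pi>\<close> reverses the sign of the cosine, so twice the integral compares \<open>E\<close> with its
  translate. For large \<open>\<xi>\<close> the vector \<open>h\<close> is short and the translate stays in an open set
  only slightly larger than \<open>E\<close>.
\<close>
lemma integral_cos_compact_le:
  fixes E :: "'a::euclidean_space set"
  assumes E: "compact E" and pos: "0 < measure lborel E"
  obtains R where "0 < R"
    and "\<And>\<xi>. R \<le> norm \<xi> \<Longrightarrow> (LINT x|lborel. indicator E x * cos (x \<bullet> \<xi>)) \<le> measure lborel E / 2"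
proof -
  define m where "m = measure lborel E"
  have Em [measurable]: "E \<in> sets borel" using E by (simp add: borel_compact)
  obtain U where U: "open U" "E \<subseteq> U" "emeasure lborel (U - E) < ennreal (m / 2)"
    using outer_regular_lborel[of E "m / 2"] Em pos by (metis m_def half_gt_zero)
  have Um [measurable]: "U \<in> sets borel" using U by simp
  have finE: "emeasure lborel E < \<infinity>" by (rule emeasure_compact_finite[OF E])
  have finD: "emeasure lborel (U - E) < \<infinity>" by (rule less_trans[OF U(3)]) simp
  have finU: "emeasure lborel U < \<infinity>"
  proof -
    have "emeasure lborel U = emeasure lborel E + emeasure lborel (U - E)"
      using U(2) by (subst plus_emeasure) (auto simp: Un_absorb1)
    then show ?thesis using finE finD by simp
  qed
  have mU: "measure lborel U \<le> m + m / 2"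
  proof -
    have "measure lborel U = measure lborel (E \<union> (U - E))"
      using U(2) by (simp add: Un_absorb1)
    also have "\<dots> = m + measure lborel (U - E)"
      unfolding m_def using finE finD by (intro measure_Union) auto
    also have "measure lborel (U - E) \<le> m / 2"
      using U(3) pos finD by (simp add: emeasure_eq_ennreal_measure m_def ennreal_less_iff)
    finally show ?thesis by simp
  qed
  obtain e where e: "0 < e" "(\<Union>x\<in>E. ball x e) \<subseteq> U"
    using compact_subset_open_imp_ball_epsilon_subset[OF E U(1,2)] by blast
  have int: "integrable lborel (\<lambda>x. indicator E (h + x) * cos (x \<bullet> \<xi>) :: real)"
    and intE: "integrable lborel (\<lambda>x. indicator E (h + x) :: real)"
    and mEh: "(LINT x|lborel. indicator E (h + x)) = m" for h \<xi> :: 'a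
  proof -
    show 1: "integrable lborel (\<lambda>x. indicator E (h + x) :: real)"
      using integrable_lborel_affine[OF integrable_indicator_compact[OF E], of 1 h] by simp
    show "integrable lborel (\<lambda>x. indicator E (h + x) * cos (x \<bullet> \<xi>) :: real)"
      by (rule Bochner_Integration.integrable_bound[OF 1])
         (auto simp: abs_mult intro!: AE_I2 mult_left_le)
    show "(LINT x|lborel. indicator E (h + x)) = m"
      using integral_lborel_affine[of "indicator E :: 'a \<Rightarrow> real" 1 h] finE
      by (simp add: m_def)
  qed
  have "(LINT x|lborel. indicator E x * cos (x \<bullet> \<xi>)) \<le> m / 2" if \<xi>: "2 * pi / e \<le> norm \<xi>" for \<xi>
  proof -
    define I where "I = (LINT x|lborel. indicator E x * cos (x \<bullet> \<xi>))"
    \<comment> \<open>The shortest vector with \<open>h \<bullet> \<xi> = \<pi>\<close>; its length is \<open>\<pi> / \<bar>\<xi>\<bar>\<close>.\<close>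
    define h where "h = (pi / (norm \<xi>)\<^sup>2) *\<^sub>R \<xi>"
    have \<xi>0: "0 < norm \<xi>" using \<xi> e pi_gt_zero by (metis divide_pos_pos less_le_trans mult_pos_pos zero_less_numeral)
    have h\<xi>: "h \<bullet> \<xi> = pi"
      using \<xi>0 by (simp add: h_def dot_square_norm)
    have "norm h = pi / norm \<xi>"
      using \<xi>0 by (simp add: h_def power2_eq_square)
    also have "\<dots> < e"
    proof -
      have "2 * pi \<le> norm \<xi> * e" using \<xi> e by (simp add: field_simps)
      then have "pi < norm \<xi> * e" using pi_gt_zero by linarith
      then show ?thesis using \<xi>0 by (simp add: field_simps)
    qed
    finally have h: "norm h < e" .
    have "I = (LINT x|lborel. indicator E (h + x) * cos ((h + x) \<bullet> \<xi>))"
      unfolding I_def by (subst integral_lborel_affine[of _ 1 h]) simp_all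
    also have "\<dots> = - (LINT x|lborel. indicator E (h + x) * cos (x \<bullet> \<xi>))"
      by (simp add: inner_add_left h\<xi> cos_add)
    finally have "2 * I = (LINT x|lborel. indicator E (0 + x) * cos (x \<bullet> \<xi>)) - (LINT x|lborel. indicator E (h + x) * cos (x \<bullet> \<xi>))"
      by (simp add: I_def)
    also have "\<dots> = (LINT x|lborel. indicator E (0 + x) * cos (x \<bullet> \<xi>) - indicator E (h + x) * cos (x \<bullet> \<xi>))"
      by (rule Bochner_Integration.integral_diff[symmetric, OF int int])
    \<comment> \<open>At a point of exactly one of \<open>E\<close> and its translate the right side equals 1, as both sets lie in \<open>U\<close>.\<close>
    also have "\<dots> \<le> (LINT x|lborel. 2 * indicator U x - indicator E (0 + x) - indicator E (h + x))"
    proof (rule integral_mono)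
      fix x
      have "x \<in> ball (h + x) e" using h by (simp add: dist_norm)
      then have "x \<in> U" if "h + x \<in> E"
        using that e(2) by blast
      moreover have "\<bar>cos (x \<bullet> \<xi>)\<bar> \<le> 1" by simp
      ultimately show "indicator E (0 + x) * cos (x \<bullet> \<xi>) - indicator E (h + x) * cos (x \<bullet> \<xi>)
          \<le> 2 * indicator U x - indicator E (0 + x) - indicator E (h + x)"
        using U(2) by (auto simp: indicator_def abs_le_iff split: if_splits)
    qed (use finU finE int[of 0 \<xi>] in \<open>auto intro!: Bochner_Integration.integrable_diff int intE simp: integrable_indicator_iff\<close>)
    also have "\<dots> = 2 * measure lborel U - m - m"
    proof -
      have iU: "integrable lborel (\<lambda>x. 2 * indicator U x :: real)"
        using finU by (simp add: integrable_indicator_iff)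
      show ?thesis
        using Bochner_Integration.integral_diff[OF Bochner_Integration.integrable_diff[OF iU intE[of 0]] intE[of h]]
          Bochner_Integration.integral_diff[OF iU intE[of 0]] mEh[of 0] mEh[of h] finU
        by simp
    qed
    finally show ?thesis using mU by (simp add: I_def)
  qed
  moreover have "0 < 2 * pi / e" using e by simp
  ultimately show thesis using that by (auto simp: m_def)
qed

text \<open>
  This lets a lower bound for \<open>1 - Re J^\<close> at the frequency \<open>2\<xi>\<close> pass to the frequency \<open>\<xi>\<close>.
\<close>
lemma one_minus_cos_double_le: "1 - cos (2 * t) \<le> 4 * (1 - cos t)" for t :: real
proof -
  have "4 * (1 - cos t) - (1 - cos (2 * t)) = 2 * (1 - cos t)\<^sup>2"
    using cos_double_cos[of t] by (simp add: power2_eq_square algebra_simps)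
  then show ?thesis by (smt (verit) zero_le_power2)
qed

text \<open>
  The kernel dominates a multiple of the indicator of some compact set of positive measure, which
  gives the gap for all large frequencies. Repeated halving of the frequency carries it down to any
  positive radius, losing a factor 4 each time.
\<close>
lemma fourier_spectral_gap:
  fixes J :: "'a::euclidean_space \<Rightarrow> real"
  assumes J: "integrable lborel J" and nonneg: "\<And>x. 0 \<le> J x" and one: "(LINT x|lborel. J x) = 1"
    and r: "0 < r"
  obtains \<delta> where "0 < \<delta>" and "\<And>\<xi>. r \<le> norm \<xi> \<Longrightarrow> Re (fourier (\<lambda>x. complex_of_real (J x)) \<xi>) \<le> 1 - \<delta>"
proof -
  have [measurable]: "J \<in> borel_measurable borel"
    using J by (auto dest: borel_measurable_integrable)
  \<comment> \<open>\<open>D = 1 - Re J^\<close> as the integral of a nonnegative function.\<close>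
  define D where "D \<xi> = (LINT x|lborel. J x * (1 - cos (x \<bullet> \<xi>)))" for \<xi>
  have intc: "integrable lborel (\<lambda>x. J x * cos (x \<bullet> \<xi>))" for \<xi>
    by (rule Bochner_Integration.integrable_bound[OF J])
       (auto simp: abs_mult intro!: AE_I2 mult_left_le)
  have intD: "integrable lborel (\<lambda>x. J x * (1 - cos (x \<bullet> \<xi>)))" for \<xi>
    using Bochner_Integration.integrable_diff[OF J intc[of \<xi>]] by (simp add: right_diff_distrib)
  have ReD: "Re (fourier (\<lambda>x. complex_of_real (J x)) \<xi>) = 1 - D \<xi>" for \<xi>
  proof -
    have "integrable lborel (\<lambda>x. complex_of_real (J x) * cis (- (x \<bullet> \<xi>)))"
      by (rule Bochner_Integration.integrable_bound[OF J]) (auto simp: norm_mult)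
    then have "Re (fourier (\<lambda>x. complex_of_real (J x)) \<xi>) = (LINT x|lborel. J x * cos (x \<bullet> \<xi>))"
      by (subst fourier_borel) (simp_all flip: integral_Re)
    also have "\<dots> = 1 - D \<xi>"
      unfolding D_def using Bochner_Integration.integral_diff[OF J intc[of \<xi>]]
      by (simp add: right_diff_distrib one)
    finally show ?thesis .
  qed
  have "\<exists>k. emeasure lborel {x. 1 / real (Suc k) \<le> J x} \<noteq> 0"
  proof (rule ccontr)
    assume "\<not> ?thesis"
    then have "(\<Union>k. {x. 1 / real (Suc k) \<le> J x}) \<in> null_sets lborel"
      by (intro null_sets_UN) (auto simp: null_sets_def)
    moreover have "{x \<in> space lborel. \<not> J x = 0} \<subseteq> (\<Union>k. {x. 1 / real (Suc k) \<le> J x})"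
    proof safe
      fix x assume "J x \<noteq> 0"
      then have "0 < J x" using nonneg[of x] by simp
      then obtain k where "inverse (real (Suc k)) < J x" using reals_Archimedean by blast
      then show "x \<in> (\<Union>k. {x. 1 / real (Suc k) \<le> J x})"
        by (auto simp: inverse_eq_divide intro!: exI[of _ k])
    qed
    ultimately have "AE x in lborel. J x = 0" by (rule AE_I')
    then have "(LINT x|lborel. J x) = 0" by (rule integral_eq_zero_AE)
    then show False using one by simp
  qed
  then obtain k where k: "emeasure lborel {x. 1 / real (Suc k) \<le> J x} \<noteq> 0" ..
  define \<eta> where "\<eta> = 1 / real (Suc k)"
  have \<eta>: "0 < \<eta>" by (simp add: \<eta>_def)
  obtain E where E: "compact E" "E \<subseteq> {x. \<eta> \<le> J x}" "0 < measure lborel E"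
    using compact_subset_of_nonnull[of "{x. \<eta> \<le> J x}"] k by (auto simp: \<eta>_def)
  obtain R where R: "0 < R"
    "\<And>\<xi>. R \<le> norm \<xi> \<Longrightarrow> (LINT x|lborel. indicator E x * cos (x \<bullet> \<xi>)) \<le> measure lborel E / 2"
    using integral_cos_compact_le[OF E(1,3)] by blast
  have [measurable]: "E \<in> sets borel" using E by (simp add: borel_compact)
  define \<delta> where "\<delta> = \<eta> * measure lborel E / 2"
  have \<delta>: "0 < \<delta>" using \<eta> E by (simp add: \<delta>_def)
  have far: "\<delta> \<le> D \<xi>" if "R \<le> norm \<xi>" for \<xi>
  proof -
    have iE: "integrable lborel (indicator E :: 'a \<Rightarrow> real)"
      by (rule integrable_indicator_compact[OF E(1)])
    have iEc: "integrable lborel (\<lambda>x. indicator E x * cos (x \<bullet> \<xi>) :: real)"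
      by (rule Bochner_Integration.integrable_bound[OF iE])
         (auto simp: abs_mult intro!: AE_I2 mult_left_le)
    have "\<delta> = \<eta> * (measure lborel E - measure lborel E / 2)"
      by (simp add: \<delta>_def)
    also have "\<dots> \<le> \<eta> * (measure lborel E - (LINT x|lborel. indicator E x * cos (x \<bullet> \<xi>)))"
      using R(2)[OF that] \<eta> by (intro mult_left_mono) auto
    also have "\<dots> = (LINT x|lborel. \<eta> * (indicator E x - indicator E x * cos (x \<bullet> \<xi>)))"
      using iE iEc by simp
    also have "\<dots> \<le> D \<xi>"
      unfolding D_def
      by (rule integral_mono') (use E(2) nonneg \<eta> intD in \<open>auto simp: indicator_def intro!: mult_right_mono\<close>)
    finally show ?thesis .
  qed
  have double: "D (2 *\<^sub>R \<xi>) \<le> 4 * D \<xi>" for \<xi>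
  proof -
    have "D (2 *\<^sub>R \<xi>) \<le> (LINT x|lborel. 4 * (J x * (1 - cos (x \<bullet> \<xi>))))"
      unfolding D_def
    proof (rule integral_mono[OF intD])
      fix x
      have "J x * (1 - cos (2 * (x \<bullet> \<xi>))) \<le> J x * (4 * (1 - cos (x \<bullet> \<xi>)))"
        by (intro mult_left_mono one_minus_cos_double_le nonneg)
      then show "J x * (1 - cos (x \<bullet> 2 *\<^sub>R \<xi>)) \<le> 4 * (J x * (1 - cos (x \<bullet> \<xi>)))"
        by (simp add: algebra_simps)
    qed (use intD in auto)
    then show ?thesis by (simp add: D_def)
  qed
  have iter: "\<delta> \<le> 4 ^ n * D \<xi>" if "R \<le> 2 ^ n * norm \<xi>" for n \<xi>
    using that
  proof (induction n arbitrary: \<xi>)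
    case 0
    then show ?case using far by simp
  next
    case (Suc n)
    then have "\<delta> \<le> 4 ^ n * D (2 *\<^sub>R \<xi>)" by (simp add: mult.assoc mult.left_commute)
    also have "\<dots> \<le> 4 ^ n * (4 * D \<xi>)" by (intro mult_left_mono double) simp
    finally show ?case by simp
  qed
  obtain n where n: "R / r < 2 ^ n" using real_arch_pow[of 2 "R / r"] by auto
  show thesis
  proof (rule that)
    show "0 < \<delta> / 4 ^ n" using \<delta> by simp
    fix \<xi> :: 'a assume "r \<le> norm \<xi>"
    then have "2 ^ n * r \<le> 2 ^ n * norm \<xi>" by simp
    moreover have "R < 2 ^ n * r" using n r by (simp add: field_simps)
    ultimately have "R \<le> 2 ^ n * norm \<xi>" by linarith
    then have "\<delta> \<le> 4 ^ n * D \<xi>" by (rule iter)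
    then show "Re (fourier (\<lambda>x. complex_of_real (J x)) \<xi>) \<le> 1 - \<delta> / 4 ^ n"
      by (simp add: ReD field_simps)
  qed
qed

section \<open>The convolution semigroup and its Fourier multiplier\<close>

text \<open>
  Integrability over Borel-Lebesgue measure includes that \<open>J\<close> is a Borel function, on which the
  product-measure arguments rest.
\<close>
locale convolution_kernel =
  fixes J :: "'a::euclidean_space \<Rightarrow> real"
  assumes J_integrable: "integrable lborel J"
    and J_nonneg: "\<And>x. 0 \<le> J x"
    and J_integral: "(LINT x|lborel. J x) = 1"
begin

lemma J_measurable [measurable]: "J \<in> borel_measurable borel"
  using J_integrable by (auto dest: borel_measurable_integrable)

lemma J_shift: "integrable lborel (\<lambda>x. J (x - y))" "(LINT x|lborel. J (x - y)) = 1"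
  and J_reflect: "integrable lborel (\<lambda>y. J (x - y))" "(LINT y|lborel. J (x - y)) = 1"
  using integrable_lborel_affine[OF J_integrable, of 1 "- y"] integral_lborel_affine[of J 1 "- y"]
    integrable_lborel_affine[OF J_integrable, of "- 1" x] integral_lborel_affine[of J "- 1" x] J_integral
  by auto

lemma conv_op_borel:
  assumes [measurable]: "u \<in> borel_measurable borel"
  shows "conv_op J u x = (LINT y|lborel. J (x - y) *\<^sub>R u y)"
  unfolding conv_op_def by (rule integral_completion) measurable

lemma conv_op_measurable [measurable]:
  assumes [measurable]: "u \<in> borel_measurable borel"
  shows "conv_op J u \<in> borel_measurable borel"
  unfolding conv_op_borel[OF assms, abs_def] by measurable

lemma norm_conv_op_le:
  assumes [measurable]: "u \<in> borel_measurable borel" and B: "\<And>x. norm (u x) \<le> B"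
  shows "norm (conv_op J u x) \<le> B"
proof -
  have "0 \<le> B" by (rule order_trans[OF norm_ge_zero B])
  have "norm (conv_op J u x) \<le> (LINT y|lborel. norm (J (x - y) *\<^sub>R u y))"
    unfolding conv_op_borel[OF assms(1)] by (rule integral_norm_bound)
  also have "\<dots> \<le> (LINT y|lborel. J (x - y) * B)"
    by (rule integral_mono') (use J_nonneg B \<open>0 \<le> B\<close> in \<open>auto intro!: J_reflect mult_left_mono\<close>)
  also have "\<dots> = B" by (simp add: J_reflect)
  finally show ?thesis .
qed

text \<open>
  The joint integrability behind every exchange of integrals for a convolution.
\<close>
lemma integrable_conv_pair:
  assumes u: "integrable lborel u"
  shows "integrable (lborel \<Otimes>\<^sub>M lborel) (\<lambda>(y, x). J (x - y) *\<^sub>R u y :: complex)"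
proof (rule lborel_pair.Fubini_integrable)
  have [measurable]: "u \<in> borel_measurable borel"
    using u by (auto dest: borel_measurable_integrable)
  show "(\<lambda>(y, x). J (x - y) *\<^sub>R u y) \<in> borel_measurable (lborel \<Otimes>\<^sub>M lborel)" by measurable
  show "integrable lborel (\<lambda>y. LINT x|lborel. norm (case (y, x) of (y, x) \<Rightarrow> J (x - y) *\<^sub>R u y))"
    using u J_nonneg by (simp add: J_shift)
  show "AE y in lborel. integrable lborel (\<lambda>x. case (y, x) of (y, x) \<Rightarrow> J (x - y) *\<^sub>R u y)"
    by (simp add: J_shift)
qed

lemma integrable_conv_op:
  assumes u: "integrable lborel u"
  shows "integrable lborel (conv_op J u)"
proof -
  have [measurable]: "u \<in> borel_measurable borel"
    using u by (auto dest: borel_measurable_integrable)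
  show ?thesis
    using lborel_pair.integrable_snd[OF integrable_conv_pair[OF u]]
    by (subst (asm) conv_op_borel[symmetric]) simp_all
qed

lemma integral_norm_conv_op_le:
  assumes u: "integrable lborel u"
  shows "(LINT x|lborel. norm (conv_op J u x)) \<le> (LINT x|lborel. norm (u x))"
proof -
  have [measurable]: "u \<in> borel_measurable borel"
    using u by (auto dest: borel_measurable_integrable)
  have pair: "integrable (lborel \<Otimes>\<^sub>M lborel) (\<lambda>(y, x). J (x - y) * norm (u y))"
    using integrable_norm[OF integrable_conv_pair[OF u]] J_nonneg by (simp add: case_prod_beta')
  have "(LINT x|lborel. norm (conv_op J u x)) \<le> (LINT x|lborel. LINT y|lborel. J (x - y) * norm (u y))"
  proof (rule integral_mono')
    show "integrable lborel (\<lambda>x. LINT y|lborel. J (x - y) * norm (u y))"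
      by (rule lborel_pair.integrable_snd[OF pair])
    fix x
    show "norm (conv_op J u x) \<le> (LINT y|lborel. J (x - y) * norm (u y))"
      unfolding conv_op_borel[OF \<open>u \<in> borel_measurable borel\<close>]
      by (rule order_trans[OF integral_norm_bound]) (simp add: J_nonneg)
  qed (simp add: J_nonneg Bochner_Integration.integral_nonneg)
  also have "\<dots> = (LINT y|lborel. LINT x|lborel. J (x - y) * norm (u y))"
    by (rule lborel_pair.Fubini_integral[OF pair])
  also have "\<dots> = (LINT y|lborel. norm (u y))"
    by (simp add: J_shift)
  finally show ?thesis .
qed

lemma fourier_conv_op:
  assumes u: "integrable lborel u"
  shows "fourier (conv_op J u) \<xi> = fourier (\<lambda>x. complex_of_real (J x)) \<xi> * fourier u \<xi>"
proof -
  have [measurable]: "u \<in> borel_measurable borel"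
    using u by (auto dest: borel_measurable_integrable)
  define h where "h y x = (J (x - y) *\<^sub>R u y) * cis (- (x \<bullet> \<xi>))" for y x
  have h: "integrable (lborel \<Otimes>\<^sub>M lborel) (\<lambda>(y, x). h y x)"
    by (rule Bochner_Integration.integrable_bound[OF integrable_conv_pair[OF u]])
       (auto simp: h_def norm_mult)
  have "fourier (conv_op J u) \<xi> = (LINT x|lborel. conv_op J u x * cis (- (x \<bullet> \<xi>)))"
    by (simp add: fourier_borel)
  also have "\<dots> = (LINT x|lborel. LINT y|lborel. h y x)"
    unfolding h_def conv_op_borel[OF \<open>u \<in> borel_measurable borel\<close>]
    by (simp only: integral_mult_left_zero)
  also have "\<dots> = (LINT y|lborel. LINT x|lborel. h y x)"
    by (rule lborel_pair.Fubini_integral[OF h])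
  also have "\<dots> = (LINT y|lborel. fourier (\<lambda>x. complex_of_real (J x)) \<xi> * (u y * cis (- (y \<bullet> \<xi>))))"
  proof (rule Bochner_Integration.integral_cong[OF refl])
    fix y
    have [measurable]: "h y \<in> borel_measurable borel"
      unfolding h_def[abs_def] by measurable
    have "(LINT x|lborel. h y x) = (LINT x|lborel. h y (y + 1 *\<^sub>R x))"
      by (subst integral_lborel_affine[of _ 1 y]) (simp_all add: h_def)
    also have "\<dots> = (LINT x|lborel. complex_of_real (J x) * cis (- (x \<bullet> \<xi>)) * (u y * cis (- (y \<bullet> \<xi>))))"
    proof (rule Bochner_Integration.integral_cong[OF refl])
      fix x
      show "h y (y + 1 *\<^sub>R x) = complex_of_real (J x) * cis (- (x \<bullet> \<xi>)) * (u y * cis (- (y \<bullet> \<xi>)))"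
        using cis_mult[of "- (x \<bullet> \<xi>)" "- (y \<bullet> \<xi>)"]
        by (simp add: h_def inner_add_left scaleR_conv_of_real algebra_simps)
    qed
    also have "\<dots> = fourier (\<lambda>x. complex_of_real (J x)) \<xi> * (u y * cis (- (y \<bullet> \<xi>)))"
      by (subst fourier_borel) simp_all
    finally show "(LINT x|lborel. h y x) = \<dots>" .
  qed
  also have "\<dots> = fourier (\<lambda>x. complex_of_real (J x)) \<xi> * fourier u \<xi>"
    by (simp add: fourier_borel)
  finally show ?thesis .
qed

lemma conv_op_iterate:
  assumes u: "integrable lborel u" and B: "\<And>x. norm (u x) \<le> B"
  shows "integrable lborel ((conv_op J ^^ k) u)"
    and "norm ((conv_op J ^^ k) u x) \<le> B"
    and "(LINT x|lborel. norm ((conv_op J ^^ k) u x)) \<le> (LINT x|lborel. norm (u x))"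
    and "fourier ((conv_op J ^^ k) u) \<xi> = fourier (\<lambda>x. complex_of_real (J x)) \<xi> ^ k * fourier u \<xi>"
proof -
  have "integrable lborel ((conv_op J ^^ k) u) \<and> (\<forall>x. norm ((conv_op J ^^ k) u x) \<le> B) \<and>
     (LINT x|lborel. norm ((conv_op J ^^ k) u x)) \<le> (LINT x|lborel. norm (u x)) \<and>
     fourier ((conv_op J ^^ k) u) \<xi> = fourier (\<lambda>x. complex_of_real (J x)) \<xi> ^ k * fourier u \<xi>"
  proof (induction k)
    case (Suc k)
    let ?v = "(conv_op J ^^ k) u"
    have v: "integrable lborel ?v" using Suc by simp
    then have "?v \<in> borel_measurable borel" by (auto dest: borel_measurable_integrable)
    then show ?case
      using Suc integrable_conv_op[OF v] norm_conv_op_le[of ?v B] fourier_conv_op[OF v, of \<xi>]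
        integral_norm_conv_op_le[OF v] by (auto simp: mult.assoc)
  qed (use assms in auto)
  then show "integrable lborel ((conv_op J ^^ k) u)"
    and "norm ((conv_op J ^^ k) u x) \<le> B"
    and "(LINT x|lborel. norm ((conv_op J ^^ k) u x)) \<le> (LINT x|lborel. norm (u x))"
    and "fourier ((conv_op J ^^ k) u) \<xi> = fourier (\<lambda>x. complex_of_real (J x)) \<xi> ^ k * fourier u \<xi>"
    by auto
qed

lemma solution_eq:
  "solution J u t x = exp (- t) *\<^sub>R (\<Sum>k. (t ^ k / fact k) *\<^sub>R (conv_op J ^^ k) u x)"
proof -
  have "(LINT y|lebesgue. \<bar>J y\<bar>) = (LINT y|lborel. J y)"
    using J_nonneg by (subst integral_completion) simp_all
  then show ?thesis by (simp add: solution_def J_integral)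
qed

text \<open>
  The exponential series is summed term by term: the uniform bound gives pointwise convergence and the
  \<open>L\<^sup>1\<close> bound of the iterates gives convergence in \<open>L\<^sup>1\<close>, which is what the Fourier transform sees.
\<close>
lemma solution_facts:
  assumes u: "integrable lborel u" and B: "\<And>x. norm (u x) \<le> B" and t: "0 \<le> t"
  shows integrable_solution: "integrable lborel (solution J u t)"
    and integral_norm_solution_le: "(LINT x|lborel. norm (solution J u t x)) \<le> (LINT x|lborel. norm (u x))"
    and fourier_solution: "fourier (solution J u t) \<xi>
       = exp (of_real t * (fourier (\<lambda>x. complex_of_real (J x)) \<xi> - 1)) * fourier u \<xi>"
proof -
  note v = conv_op_iterate[OF u B]
  define f where "f k x = (t ^ k / fact k) *\<^sub>R (conv_op J ^^ k) u x" for k x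
  define L where "L = (LINT x|lborel. norm (u x))"
  have exps: "(\<lambda>k. t ^ k / fact k * c) sums (exp t * c)" for c
    using sums_mult2[OF exp_converges[of t], of c] by (simp add: field_simps)
  have f: "integrable lborel (f k)" for k
    unfolding f_def by (intro integrable_scaleR_right v)
  have [measurable]: "f k \<in> borel_measurable borel" for k
    using f[of k] by (auto dest: borel_measurable_integrable)
  have normf: "norm (f k x) \<le> t ^ k / fact k * B" for k x
    unfolding f_def using t v(2)[of k x] by (auto intro!: divide_right_mono mult_left_mono)
  have intf: "(LINT x|lborel. norm (f k x)) \<le> t ^ k / fact k * L" for k
    unfolding f_def L_def using t v(3)[of k] by (auto intro!: divide_right_mono mult_left_mono)
  have sf: "summable (\<lambda>k. norm (f k x))" for x
    by (rule summable_comparison_test'[OF sums_summable[OF exps]]) (use normf in simp)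
  have sif: "summable (\<lambda>k. LINT x|lborel. norm (f k x))"
    by (rule summable_comparison_test'[OF sums_summable[OF exps[of L]]]) (use intf in simp)
  have sol: "solution J u t = (\<lambda>x. exp (- t) *\<^sub>R (\<Sum>k. f k x))"
    by (simp add: solution_eq f_def fun_eq_iff)
  have int: "integrable lborel (\<lambda>x. \<Sum>k. f k x)"
    using sf sif f by (intro integrable_suminf) auto
  show "integrable lborel (solution J u t)"
    unfolding sol by (intro integrable_scaleR_right int)
  have "(LINT x|lborel. norm (solution J u t x)) = exp (- t) * (LINT x|lborel. norm (\<Sum>k. f k x))"
    by (simp add: sol)
  also have "\<dots> \<le> exp (- t) * (LINT x|lborel. (\<Sum>k. norm (f k x)))"
    using sf sif f
    by (intro mult_left_mono integral_mono integrable_suminf integrable_norm int summable_norm) auto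
  also have "(LINT x|lborel. (\<Sum>k. norm (f k x))) = (\<Sum>k. (LINT x|lborel. norm (f k x)))"
    using sf sif f by (intro integral_suminf) auto
  also have "exp (- t) * \<dots> \<le> exp (- t) * (\<Sum>k. t ^ k / fact k * L)"
    using sif intf sums_summable[OF exps] by (intro mult_left_mono suminf_le) auto
  also have "\<dots> = L"
    unfolding sums_unique[OF exps[of L], symmetric] by (simp flip: mult.assoc exp_add)
  finally show "(LINT x|lborel. norm (solution J u t x)) \<le> (LINT x|lborel. norm (u x))"
    by (simp add: L_def)
  let ?F = "fourier (\<lambda>x. complex_of_real (J x)) \<xi>"
  have coeff: "(LINT x|lborel. f k x * cis (- (x \<bullet> \<xi>))) = (of_real t * ?F) ^ k /\<^sub>R fact k * fourier u \<xi>" for k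
  proof -
    have [measurable]: "(conv_op J ^^ k) u \<in> borel_measurable borel"
      using v(1)[of k] by (auto dest: borel_measurable_integrable)
    have "(LINT x|lborel. f k x * cis (- (x \<bullet> \<xi>))) = (t ^ k / fact k) *\<^sub>R fourier ((conv_op J ^^ k) u) \<xi>"
      by (simp add: f_def fourier_borel flip: integral_scaleR_right)
    then show ?thesis
      by (simp add: v(4) scaleR_conv_of_real power_mult_distrib field_simps)
  qed
  have "(LINT x|lborel. (\<Sum>k. f k x) * cis (- (x \<bullet> \<xi>))) = (LINT x|lborel. (\<Sum>k. f k x * cis (- (x \<bullet> \<xi>))))"
    by (simp only: suminf_mult2[OF summable_norm_cancel[OF sf]])
  also have "\<dots> = (\<Sum>k. (LINT x|lborel. f k x * cis (- (x \<bullet> \<xi>))))"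
  proof (rule integral_suminf)
    show "integrable lborel (\<lambda>x. f k x * cis (- (x \<bullet> \<xi>)))" for k
      by (rule Bochner_Integration.integrable_bound[OF f[of k]]) (auto simp: norm_mult)
  qed (use sf sif in \<open>auto simp: norm_mult\<close>)
  also have "\<dots> = (\<Sum>k. (of_real t * ?F) ^ k /\<^sub>R fact k * fourier u \<xi>)"
    by (simp only: coeff)
  also have "\<dots> = exp (of_real t * ?F) * fourier u \<xi>"
    by (rule sums_unique[OF sums_mult2[OF exp_converges], symmetric])
  finally have "fourier (\<lambda>x. \<Sum>k. f k x) \<xi> = exp (of_real t * ?F) * fourier u \<xi>"
    by (subst fourier_borel) auto
  moreover have "fourier (solution J u t) \<xi> = exp (- t) *\<^sub>R fourier (\<lambda>x. \<Sum>k. f k x) \<xi>"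
    unfolding sol by (subst (1 2) fourier_borel) simp_all
  moreover have "exp (of_real t * (?F - 1)) = exp (- t) *\<^sub>R exp (of_real t * ?F)"
    by (simp add: scaleR_conv_of_real exp_of_real[symmetric] ring_distribs flip: exp_add)
  ultimately show "fourier (solution J u t) \<xi> = exp (of_real t * (?F - 1)) * fourier u \<xi>"
    by simp
qed

end

section \<open>The symbol near the origin at the diffusive scale\<close>

lemma integrable_inverse_one_plus_square: "integrable lborel (\<lambda>x::real. 1 / (1 + x\<^sup>2))"
  using integrable_inverse_1_plus_square
  by (simp add: set_integrable_def inverse_eq_divide)

text \<open>
  The function decays faster than any power, hence is dominated by a multiple of
  \<open>(1 + \<bar>x\<bar>\<^sup>2)\<^bsup>-n\<^esup>\<close>, which is at most the product of the one-dimensional functions \<open>1 / (1 + x\<^sub>b\<^sup>2)\<close>.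
\<close>
lemma integrable_exp_neg_norm_powr:
  fixes c a :: real
  assumes c: "0 < c" and a: "0 < a"
  shows "integrable lborel (\<lambda>x::'a::euclidean_space. exp (- (c * norm x powr a)))"
proof -
  let ?N = "DIM('a)"
  have "((\<lambda>r. (1 + r\<^sup>2) powr real ?N * exp (- (c * r powr a))) \<longlongrightarrow> 0) at_top"
    using c a by real_asymp
  then have "\<forall>\<^sub>F r in at_top. (1 + r\<^sup>2) powr real ?N * exp (- (c * r powr a)) < 1"
    by (rule order_tendstoD) simp
  then obtain R where R: "\<And>r. R \<le> r \<Longrightarrow> (1 + r\<^sup>2) powr real ?N * exp (- (c * r powr a)) < 1"
    by (auto simp: eventually_at_top_linorder)
  define M where "M = max 1 ((1 + R\<^sup>2) ^ ?N)"
  have bound: "(1 + r\<^sup>2) ^ ?N * exp (- (c * r powr a)) \<le> M" if "0 \<le> r" for r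
  proof (cases "R \<le> r")
    case True
    have "0 < 1 + r\<^sup>2" by (simp add: add_pos_nonneg)
    then have "(1 + r\<^sup>2) ^ ?N * exp (- (c * r powr a)) \<le> 1"
      using R[OF True] by (simp add: powr_realpow)
    then show ?thesis unfolding M_def by (rule order_trans) simp
  next
    case False
    then have "(1 + r\<^sup>2) ^ ?N * exp (- (c * r powr a)) \<le> (1 + R\<^sup>2) ^ ?N * 1"
      using that c by (intro mult_mono power_mono add_left_mono) auto
    then show ?thesis by (simp add: M_def)
  qed
  have int: "integrable lborel (\<lambda>x::'a. M * (\<Prod>b\<in>Basis. 1 / (1 + (x \<bullet> b)\<^sup>2)))"
    by (intro integrable_mult_right integral_prod_Basis(1) integrable_inverse_one_plus_square)
  show ?thesis
  proof (rule Bochner_Integration.integrable_bound[OF int])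
    show "AE x in lborel. norm (exp (- (c * norm x powr a))) \<le> norm (M * (\<Prod>b\<in>Basis. 1 / (1 + ((x::'a) \<bullet> b)\<^sup>2)))"
    proof (rule AE_I2)
      fix x :: 'a
      have pos: "0 < 1 + s\<^sup>2" for s :: real by (simp add: add_pos_nonneg)
      have "(\<Prod>b\<in>(Basis::'a set). 1 + (x \<bullet> b)\<^sup>2) \<le> (\<Prod>b\<in>(Basis::'a set). 1 + (norm x)\<^sup>2)"
        by (intro prod_mono) (auto simp: Basis_le_norm power_mono intro!: abs_le_square_iff[THEN iffD1])
      then have "(\<Prod>b\<in>(Basis::'a set). 1 + (x \<bullet> b)\<^sup>2) * exp (- (c * norm x powr a)) \<le> (1 + (norm x)\<^sup>2) ^ ?N * exp (- (c * norm x powr a))"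
        by (intro mult_right_mono) auto
      also have "\<dots> \<le> M" by (rule bound) simp
      finally have "exp (- (c * norm x powr a)) \<le> M * (\<Prod>b\<in>(Basis::'a set). 1 / (1 + (x \<bullet> b)\<^sup>2))"
        by (simp add: prod_dividef pos prod_pos pos_le_divide_eq mult.commute)
      then show "norm (exp (- (c * norm x powr a))) \<le> norm (M * (\<Prod>b\<in>Basis. 1 / (1 + (x \<bullet> b)\<^sup>2)))"
        by (simp add: abs_of_nonneg order_trans[OF _ abs_ge_self])
    qed
  qed measurable
qed

text \<open>
  A power of the logarithm cannot destroy the monotonicity of a positive power close to 0: in the variable
  \<open>q = ln (1/x)\<close> the logarithm of the function is \<open>- a q + \<mu> ln q\<close>, with slope
  \<open>- a + \<mu>/q \<le> 0\<close> once \<open>q \<ge> \<bar>\<mu>\<bar>/a\<close>.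
\<close>
lemma powr_ln_powr_mono:
  fixes a \<mu> :: real
  assumes a: "0 < a" and x: "0 < x" "x \<le> y" and y: "y \<le> exp (- (1 + \<bar>\<mu>\<bar> / a))"
  shows "x powr a * ln (1 / x) powr \<mu> \<le> y powr a * ln (1 / y) powr \<mu>"
proof -
  have y0: "0 < y" using x by simp
  define p where "p = ln (1 / x)"
  define q where "q = ln (1 / y)"
  have "ln y \<le> - (1 + \<bar>\<mu>\<bar> / a)" using y y0 by (metis ln_exp ln_le_cancel_iff exp_gt_zero)
  then have q: "1 + \<bar>\<mu>\<bar> / a \<le> q" using y0 by (simp add: q_def ln_div)
  then have q0: "0 < q" using a by (smt (verit) divide_nonneg_pos abs_ge_zero)
  have pq: "q \<le> p" using x y0 by (simp add: p_def q_def frac_le)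
  have "\<mu> * (ln p - ln q) \<le> \<bar>\<mu>\<bar> * (ln p - ln q)"
    using pq q0 by (intro mult_right_mono) auto
  also have "ln p - ln q \<le> (p - q) / q"
    using ln_le_minus_one[of "p / q"] pq q0 by (simp add: ln_div diff_divide_distrib)
  then have "\<bar>\<mu>\<bar> * (ln p - ln q) \<le> \<bar>\<mu>\<bar> * ((p - q) / q)"
    by (intro mult_left_mono) auto
  also have "\<dots> = (\<bar>\<mu>\<bar> / q) * (p - q)" by simp
  also have "\<dots> \<le> a * (p - q)"
  proof (intro mult_right_mono)
    have "\<bar>\<mu>\<bar> \<le> a * q" using q a by (simp add: field_simps)
    then show "\<bar>\<mu>\<bar> / q \<le> a" using q0 by (simp add: field_simps)
  qed (use pq in simp)
  finally have "a * - p + \<mu> * ln p \<le> a * - q + \<mu> * ln q"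
    by (simp add: algebra_simps)
  moreover have "ln x = - p" "ln y = - q" "p \<noteq> 0"
    using x y0 pq q0 by (auto simp: p_def q_def ln_div)
  then have "x powr a * p powr \<mu> = exp (a * - p + \<mu> * ln p)"
    and "y powr a * q powr \<mu> = exp (a * - q + \<mu> * ln q)"
    using x y0 q0 by (simp_all add: powr_def flip: exp_add)
  ultimately show ?thesis by (simp add: p_def q_def)
qed

text \<open>
  The factor \<open>(ln t)\<^sup>\<mu>\<close> in the scale is invisible to the logarithm at leading order. Consequently
  \<open>ln s\<close> and \<open>ln t\<close> are interchangeable up to a constant for the scale \<open>s\<close>.
\<close>
lemma ln_scale_ratio_tendsto:
  fixes \<sigma> \<mu> :: real
  assumes "0 < \<sigma>"
  shows "((\<lambda>t. ln ((t * ln t powr \<mu>) powr (1 / \<sigma>)) / ln t) \<longlongrightarrow> 1 / \<sigma>) at_top"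
proof (rule Lim_transform_eventually)
  show "((\<lambda>t. (1 / \<sigma>) * (1 + \<mu> * (ln (ln t) / ln t))) \<longlongrightarrow> 1 / \<sigma>) at_top"
  proof -
    have "((\<lambda>t::real. ln (ln t) / ln t) \<longlongrightarrow> 0) at_top" by real_asymp
    then have "((\<lambda>t. (1 / \<sigma>) * (1 + \<mu> * (ln (ln t) / ln t))) \<longlongrightarrow> (1 / \<sigma>) * (1 + \<mu> * 0)) at_top"
      by (intro tendsto_intros)
    then show ?thesis by simp
  qed
  show "\<forall>\<^sub>F t in at_top. (1 / \<sigma>) * (1 + \<mu> * (ln (ln t) / ln t)) = ln ((t * ln t powr \<mu>) powr (1 / \<sigma>)) / ln t"
    using eventually_gt_at_top[of 1]
  proof eventually_elim
    case (elim t)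
    then have "0 < ln t" by simp
    then show ?case using elim by (simp add: ln_powr ln_mult field_simps)
  qed
qed

text \<open>
  Split \<open>x\<^sup>\<sigma>\<close> into two equal powers. One of them together with the logarithm is monotone in \<open>x\<close>, so for
  \<open>x \<ge> 1/s\<close> it may be evaluated at \<open>1/s\<close>, where the definition of the scale turns
  the logarithm into \<open>(ln s / ln t)\<^sup>\<mu>\<close>, which converges to a positive number.
\<close>
lemma scaled_symbol_lower_bound:
  fixes \<sigma> \<mu> :: real
  assumes \<sigma>: "0 < \<sigma>"
  obtains c r where "0 < c" and "0 < r" and "r < 1"
    and "\<forall>\<^sub>F t in at_top. \<forall>x. 1 \<le> (t * ln t powr \<mu>) powr (1 / \<sigma>) * x \<longrightarrow> x \<le> r \<longrightarrow>
      c * ((t * ln t powr \<mu>) powr (1 / \<sigma>) * x) powr (\<sigma> / 2) \<le> t * (x powr \<sigma> * ln (1 / x) powr \<mu>)"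
proof (rule that)
  define a where "a = \<sigma> / 2"
  \<comment> \<open>Below \<open>r\<close> the function \<open>x\<^sup>a (ln (1/x))\<^sup>\<mu>\<close> is monotone.\<close>
  define r where "r = exp (- (1 + \<bar>\<mu>\<bar> / a))"
  \<comment> \<open>Half of the limit of \<open>(ln s / ln t)\<^sup>\<mu>\<close>.\<close>
  define c where "c = (1 / \<sigma>) powr \<mu> / 2"
  have a: "0 < a" using \<sigma> by (simp add: a_def)
  show "0 < c" using \<sigma> by (simp add: c_def)
  show "0 < r" by (simp add: r_def)
  show "r < 1" using divide_nonneg_pos[OF abs_ge_zero[of \<mu>] a] unfolding r_def by simp
  let ?s = "\<lambda>t. (t * ln t powr \<mu>) powr (1 / \<sigma>)"
  have "((\<lambda>t. (ln (?s t) / ln t) powr \<mu>) \<longlongrightarrow> (1 / \<sigma>) powr \<mu>) at_top"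
    using \<sigma> by (intro tendsto_powr ln_scale_ratio_tendsto tendsto_const) auto
  then have 1: "\<forall>\<^sub>F t in at_top. c < (ln (?s t) / ln t) powr \<mu>"
    by (rule order_tendstoD) (use \<sigma> in \<open>simp add: c_def\<close>)
  have 2: "\<forall>\<^sub>F t in at_top. 0 < ln (?s t) / ln t"
    by (rule order_tendstoD[OF ln_scale_ratio_tendsto[OF \<sigma>]]) (use \<sigma> in simp)
  show "\<forall>\<^sub>F t in at_top. \<forall>x. 1 \<le> ?s t * x \<longrightarrow> x \<le> r \<longrightarrow>
      c * (?s t * x) powr (\<sigma> / 2) \<le> t * (x powr \<sigma> * ln (1 / x) powr \<mu>)"
    using 1 2 eventually_gt_at_top[of 1]
  proof eventually_elim
    case (elim t)
    define s where "s = ?s t"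
    have lnt: "0 < ln t" using elim(3) by simp
    have s: "0 < s" using elim(3) lnt by (simp add: s_def)
    have "0 < ln s / ln t" using elim(2) by (simp only: s_def)
    then have lns: "0 < ln s" using lnt by (auto simp: zero_less_divide_iff)
    have t: "t = s powr \<sigma> / ln t powr \<mu>"
      using \<sigma> lnt elim(3) by (simp add: s_def powr_powr)
    show ?case
    proof (intro allI impI)
      fix x assume x: "1 \<le> ?s t * x" "x \<le> r"
      then have sx: "1 / s \<le> x" using s by (simp add: s_def field_simps)
      then have x0: "0 < x" using s by (smt (verit) divide_pos_pos)
      have "c * (s * x) powr a \<le> (ln s / ln t) powr \<mu> * (s * x) powr a"
        using elim(1) by (intro mult_right_mono) (auto simp: s_def)
      also have "\<dots> = t * x powr a * ((1 / s) powr a * ln (1 / (1 / s)) powr \<mu>)"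
      proof -
        have "s powr \<sigma> = s powr a * s powr a" by (simp add: a_def flip: powr_add)
        then have "t = s powr a * s powr a / ln t powr \<mu>" using t by simp
        moreover have key: "l / q * (p * z) = t * z * ((1 / p) * l)" if "t = p * p / q" "0 < p" "0 < q" for p q z l
          using that by (simp add: field_simps)
        ultimately have "ln s powr \<mu> / ln t powr \<mu> * (s powr a * x powr a)
            = t * x powr a * ((1 / s powr a) * ln s powr \<mu>)"
          using s lnt by (intro key) auto
        then show ?thesis
          using s x0 lns lnt by (simp add: powr_mult powr_divide)
      qed
      also have "\<dots> \<le> t * x powr a * (x powr a * ln (1 / x) powr \<mu>)"
        using sx x(2) s a elim(3) unfolding r_def
        by (intro mult_left_mono powr_ln_powr_mono) auto
      also have "\<dots> = t * (x powr \<sigma> * ln (1 / x) powr \<mu>)"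
        by (simp add: a_def mult.assoc flip: powr_add)
      finally show "c * (?s t * x) powr (\<sigma> / 2) \<le> t * (x powr \<sigma> * ln (1 / x) powr \<mu>)"
        by (simp add: s_def a_def)
    qed
  qed
qed

lemma exp_decay_le_scale_powr:
  fixes \<sigma> \<mu> \<delta> n :: real
  assumes "0 < \<sigma>" and "0 < \<delta>"
  shows "\<forall>\<^sub>F t in at_top. exp (- \<delta> * t) \<le> (t * ln t powr \<mu>) powr (- (n / \<sigma>))"
proof -
  have "((\<lambda>t::real. ln t / t) \<longlongrightarrow> 0) at_top" "((\<lambda>t::real. ln (ln t) / t) \<longlongrightarrow> 0) at_top"
    by real_asymp+
  then have "((\<lambda>t. (n / \<sigma>) * (ln t / t + \<mu> * (ln (ln t) / t))) \<longlongrightarrow> (n / \<sigma>) * (0 + \<mu> * 0)) at_top"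
    by (intro tendsto_intros)
  then have "\<forall>\<^sub>F t in at_top. (n / \<sigma>) * (ln t / t + \<mu> * (ln (ln t) / t)) < \<delta>"
    by (rule order_tendstoD) (use assms in simp)
  then show ?thesis
    using eventually_gt_at_top[of 1]
  proof eventually_elim
    case (elim t)
    have lnt: "0 < ln t" using elim by simp
    have "(n / \<sigma>) * (ln t + \<mu> * ln (ln t)) = ((n / \<sigma>) * (ln t / t + \<mu> * (ln (ln t) / t))) * t"
      using elim assms by (simp add: field_simps)
    also have "\<dots> \<le> \<delta> * t"
      using elim by (intro mult_right_mono) auto
    finally have "- \<delta> * t \<le> - (n / \<sigma>) * (ln t + \<mu> * ln (ln t))" by simp
    also have "ln t + \<mu> * ln (ln t) = ln (t * ln t powr \<mu>)"
      using elim lnt by (simp add: ln_mult ln_powr)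
    finally show ?case
      using elim lnt by (simp add: powr_def)
  qed
qed

section \<open>Decay of the Fourier transform of the solution\<close>

context convolution_kernel
begin

lemma Re_fourier_kernel_le_1: "Re (fourier (\<lambda>x. complex_of_real (J x)) \<xi>) \<le> 1"
proof -
  have "norm (fourier (\<lambda>x. complex_of_real (J x)) \<xi>) \<le> (LINT x|lborel. norm (complex_of_real (J x)))"
    by (rule norm_fourier_le) simp
  also have "\<dots> = 1" using J_nonneg J_integral by simp
  finally show ?thesis using complex_Re_le_cmod order_trans by blast
qed

lemma norm_fourier_solution:
  assumes "integrable lborel u" and "\<And>x. norm (u x) \<le> B" and "0 \<le> t"
  shows "norm (fourier (solution J u t) \<xi>)
    = exp (t * (Re (fourier (\<lambda>x. complex_of_real (J x)) \<xi>) - 1)) * norm (fourier u \<xi>)"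
  unfolding fourier_solution[OF assms] by (simp add: norm_mult)

lemma fourier_solution_L1:
  assumes u: "integrable lborel u" and B: "\<And>x. norm (u x) \<le> B" and t: "0 \<le> t"
    and fu: "integrable lborel (fourier u)"
  shows "integrable lborel (fourier (solution J u t))"
    and "(LINT \<xi>|lborel. norm (fourier (solution J u t) \<xi>)) \<le> (LINT \<xi>|lborel. norm (fourier u \<xi>))"
proof -
  have le: "norm (fourier (solution J u t) \<xi>) \<le> norm (fourier u \<xi>)" for \<xi>
    unfolding norm_fourier_solution[OF u B t]
    using t Re_fourier_kernel_le_1[of \<xi>] by (intro mult_left_le_one_le) (auto simp: mult_nonneg_nonpos)
  have [measurable]: "solution J u t \<in> borel_measurable borel"
    using integrable_solution[OF u B t] by (auto dest: borel_measurable_integrable)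
  show "integrable lborel (fourier (solution J u t))"
    by (rule Bochner_Integration.integrable_bound[OF fu]) (use le in auto)
  show "(LINT \<xi>|lborel. norm (fourier (solution J u t) \<xi>)) \<le> (LINT \<xi>|lborel. norm (fourier u \<xi>))"
    by (rule integral_mono'[OF integrable_norm[OF fu]]) (use le in auto)
qed

text \<open>
  Frequencies are split at a fixed radius \<open>r1\<close>. Outside, the spectral gap gives exponential decay.
  Inside, the multiplier is at most a constant times \<open>E (s \<xi>)\<close> with \<open>E\<close> a stretched exponential, also where
  \<open>s \<bar>\<xi>\<bar> \<le> 1\<close>, since there it is at most 1. The constant is independent of \<open>u\<close> and
  of its pointwise bound \<open>B\<close>, and so is the time from which the estimate holds.
\<close>
theorem fourier_solution_decay:
  assumes \<sigma>: "0 < \<sigma>" and A: "0 < A"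
    and asymp: "(\<lambda>\<xi>. fourier (\<lambda>x. complex_of_real (J x)) \<xi>
              - complex_of_real (1 - A * norm \<xi> powr \<sigma> * ln (1 / norm \<xi>) powr \<mu>))
         \<in> o[at 0](\<lambda>\<xi>. complex_of_real (norm \<xi> powr \<sigma> * ln (1 / norm \<xi>) powr \<mu>))"
  obtains C where "1 \<le> C"
    and "\<forall>\<^sub>F t in at_top. \<forall>u B. integrable lborel u \<longrightarrow> (\<forall>x. norm (u x) \<le> B) \<longrightarrow> integrable lborel (fourier u) \<longrightarrow>
      (LINT \<xi>|lborel. norm (fourier (solution J u t) \<xi>))
        \<le> C * ((LINT x|lborel. norm (u x)) + (LINT \<xi>|lborel. norm (fourier u \<xi>)))
            * (t * ln t powr \<mu>) powr (- (real DIM('a) / \<sigma>))"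
proof -
  let ?F = "fourier (\<lambda>x. complex_of_real (J x))"
  let ?s = "\<lambda>t. (t * ln t powr \<mu>) powr (1 / \<sigma>)"
  define w where "w x = x powr \<sigma> * ln (1 / x) powr \<mu>" for x
  have w: "0 \<le> w x" for x by (simp add: w_def)
  have "\<forall>\<^sub>F \<xi> in at 0. norm (?F \<xi> - complex_of_real (1 - A * norm \<xi> powr \<sigma> * ln (1 / norm \<xi>) powr \<mu>))
      \<le> A / 2 * norm (complex_of_real (norm \<xi> powr \<sigma> * ln (1 / norm \<xi>) powr \<mu>))"
    using A by (intro landau_o.smallD[OF asymp]) simp
  then obtain d where d: "0 < d" "\<And>\<xi>. \<xi> \<noteq> 0 \<Longrightarrow> norm \<xi> < d \<Longrightarrow>
      norm (?F \<xi> - complex_of_real (1 - A * w (norm \<xi>))) \<le> A / 2 * w (norm \<xi>)"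
    unfolding eventually_at by (auto simp: w_def norm_mult mult.assoc simp del: of_real_diff of_real_mult)
  have near: "Re (?F \<xi>) - 1 \<le> - (A / 2) * w (norm \<xi>)" if "\<xi> \<noteq> 0" "norm \<xi> < d" for \<xi>
  proof -
    have "Re (?F \<xi>) - (1 - A * w (norm \<xi>)) = Re (?F \<xi> - complex_of_real (1 - A * w (norm \<xi>)))"
      by simp
    also have "\<dots> \<le> A / 2 * w (norm \<xi>)"
      using d(2)[OF that] complex_Re_le_cmod order_trans by blast
    finally show ?thesis by simp
  qed
  obtain c r where cr: "0 < c" "0 < r" "r < 1"
    and low: "\<forall>\<^sub>F t in at_top. \<forall>x. 1 \<le> ?s t * x \<longrightarrow> x \<le> r \<longrightarrow>
      c * (?s t * x) powr (\<sigma> / 2) \<le> t * (x powr \<sigma> * ln (1 / x) powr \<mu>)"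
    by (rule scaled_symbol_lower_bound[OF \<sigma>, of \<mu>], rule that)
  define r1 where "r1 = min r (d / 2)"
  have r1: "0 < r1" "r1 \<le> r" "r1 < d" using cr d by (auto simp: r1_def)
  obtain \<delta> where \<delta>: "0 < \<delta>" "\<And>\<xi>. r1 \<le> norm \<xi> \<Longrightarrow> Re (?F \<xi>) \<le> 1 - \<delta>"
    by (rule fourier_spectral_gap[OF J_integrable J_nonneg J_integral r1(1)], rule that)
  define c' where "c' = A / 2 * c"
  have c': "0 < c'" using A cr by (simp add: c'_def)
  define E :: "'a \<Rightarrow> real" where "E \<eta> = exp (- (c' * norm \<eta> powr (\<sigma> / 2)))" for \<eta>
  have E: "integrable lborel E"
    unfolding E_def using c' \<sigma> by (intro integrable_exp_neg_norm_powr) auto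
  define K where "K = (LINT \<eta>|lborel. E \<eta>)"
  have K: "0 \<le> K" by (simp add: K_def E_def)
  show thesis
  proof (rule that)
    show "1 \<le> exp c' * K + 1" using K by simp
    show "\<forall>\<^sub>F t in at_top. \<forall>u B. integrable lborel u \<longrightarrow> (\<forall>x. norm (u x) \<le> B) \<longrightarrow> integrable lborel (fourier u) \<longrightarrow>
      (LINT \<xi>|lborel. norm (fourier (solution J u t) \<xi>))
        \<le> (exp c' * K + 1) * ((LINT x|lborel. norm (u x)) + (LINT \<xi>|lborel. norm (fourier u \<xi>)))
            * (t * ln t powr \<mu>) powr (- (real DIM('a) / \<sigma>))"
      using low exp_decay_le_scale_powr[OF \<sigma> \<delta>(1), of \<mu> "real DIM('a)"] eventually_gt_at_top[of 1]
    proof (eventually_elim, intro allI impI)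
      fix t B :: real and u :: "'a \<Rightarrow> complex"
      assume low: "\<forall>x. 1 \<le> ?s t * x \<longrightarrow> x \<le> r \<longrightarrow>
          c * (?s t * x) powr (\<sigma> / 2) \<le> t * (x powr \<sigma> * ln (1 / x) powr \<mu>)"
        and decay: "exp (- \<delta> * t) \<le> (t * ln t powr \<mu>) powr (- (real DIM('a) / \<sigma>))"
        and t: "1 < t" and u: "integrable lborel u" and uB: "\<forall>x. norm (u x) \<le> B"
        and fu: "integrable lborel (fourier u)"
      have [measurable]: "u \<in> borel_measurable borel"
        using u by (auto dest: borel_measurable_integrable)
      define s where "s = ?s t"
      have s: "0 < s" using t by (simp add: s_def)
      define U where "U = (LINT x|lborel. norm (u x))"
      define V where "V = (LINT \<xi>|lborel. norm (fourier u \<xi>))"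
      have U: "0 \<le> U" and V: "0 \<le> V" by (simp_all add: U_def V_def)
      have "exp (t * (Re (?F \<xi>) - 1)) * norm (fourier u \<xi>)
          \<le> U * exp c' * E (0 + s *\<^sub>R \<xi>) + exp (- \<delta> * t) * norm (fourier u \<xi>)" for \<xi>
      proof (cases "r1 \<le> norm \<xi>")
        case True
        have "t * (Re (?F \<xi>) - 1) \<le> t * - \<delta>"
          using \<delta>(2)[OF True] t by (intro mult_left_mono) auto
        then have "exp (t * (Re (?F \<xi>) - 1)) * norm (fourier u \<xi>) \<le> exp (- \<delta> * t) * norm (fourier u \<xi>)"
          by (intro mult_right_mono) (auto simp: mult.commute)
        also have "\<dots> \<le> U * exp c' * E (0 + s *\<^sub>R \<xi>) + exp (- \<delta> * t) * norm (fourier u \<xi>)"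
          using U by (simp add: E_def)
        finally show ?thesis .
      next
        case False
        \<comment> \<open>The summand \<open>c'\<close> on the right makes the bound valid for \<open>s \<bar>\<xi>\<bar> \<le> 1\<close> as well.\<close>
        have "t * (Re (?F \<xi>) - 1) \<le> c' - c' * norm (s *\<^sub>R \<xi>) powr (\<sigma> / 2)"
        proof (cases "1 \<le> s * norm \<xi>")
          case True
          then have "\<xi> \<noteq> 0" by auto
          have "t * (Re (?F \<xi>) - 1) \<le> t * (- (A / 2) * w (norm \<xi>))"
            using near[of \<xi>] \<open>\<xi> \<noteq> 0\<close> False r1 t by (intro mult_left_mono) auto
          also have "\<dots> = - (A / 2) * (t * w (norm \<xi>))" by simp
          also have "\<dots> \<le> - (A / 2) * (c * (s * norm \<xi>) powr (\<sigma> / 2))"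
            using low[rule_format, of "norm \<xi>"] True False r1 A
            by (intro mult_left_mono_neg) (auto simp: s_def w_def)
          also have "\<dots> \<le> c' - c' * norm (s *\<^sub>R \<xi>) powr (\<sigma> / 2)"
            using s c' by (simp add: c'_def)
          finally show ?thesis .
        next
          case False
          then have "norm (s *\<^sub>R \<xi>) powr (\<sigma> / 2) \<le> 1"
            using s \<sigma> by (intro powr_le1) auto
          then have "0 \<le> c' - c' * norm (s *\<^sub>R \<xi>) powr (\<sigma> / 2)"
            using c' by (simp add: mult_left_le)
          moreover have "t * (Re (?F \<xi>) - 1) \<le> 0"
            using Re_fourier_kernel_le_1[of \<xi>] t by (intro mult_nonneg_nonpos) auto
          ultimately show ?thesis by linarith
        qed
        then have "exp (t * (Re (?F \<xi>) - 1)) \<le> exp c' * E (0 + s *\<^sub>R \<xi>)"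
          by (simp add: E_def flip: exp_add)
        then have "exp (t * (Re (?F \<xi>) - 1)) * norm (fourier u \<xi>) \<le> exp c' * E (0 + s *\<^sub>R \<xi>) * U"
          using norm_fourier_le[of u \<xi>] by (intro mult_mono) (auto simp: U_def E_def)
        also have "\<dots> \<le> U * exp c' * E (0 + s *\<^sub>R \<xi>) + exp (- \<delta> * t) * norm (fourier u \<xi>)"
          by (simp add: mult_ac)
        finally show ?thesis .
      qed
      then have pw: "norm (fourier (solution J u t) \<xi>)
          \<le> U * exp c' * E (0 + s *\<^sub>R \<xi>) + exp (- \<delta> * t) * norm (fourier u \<xi>)" for \<xi>
        using norm_fourier_solution[OF u uB[rule_format], of t \<xi>] t by simp
      have Es: "integrable lborel (\<lambda>\<xi>. E (0 + s *\<^sub>R \<xi>))"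
        using s by (intro integrable_lborel_affine E) simp
      have "(LINT \<xi>|lborel. norm (fourier (solution J u t) \<xi>))
          \<le> (LINT \<xi>|lborel. U * exp c' * E (0 + s *\<^sub>R \<xi>) + exp (- \<delta> * t) * norm (fourier u \<xi>))"
        using pw Es fu U by (intro integral_mono') (auto simp: E_def)
      also have "\<dots> = U * exp c' * (LINT \<xi>|lborel. E (0 + s *\<^sub>R \<xi>)) + exp (- \<delta> * t) * V"
        using Es fu by (simp add: V_def)
      also have "(LINT \<xi>|lborel. E (0 + s *\<^sub>R \<xi>)) = (t * ln t powr \<mu>) powr (- (real DIM('a) / \<sigma>)) * K"
      proof -
        have "K = s ^ DIM('a) * (LINT \<xi>|lborel. E (0 + s *\<^sub>R \<xi>))"
          unfolding K_def using s E by (subst integral_lborel_affine[of E s 0]) (auto dest: borel_measurable_integrable)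
        moreover have "(t * ln t powr \<mu>) powr (- (real DIM('a) / \<sigma>)) * s ^ DIM('a) = 1"
          using s t by (simp add: s_def powr_powr flip: powr_realpow powr_add)
        ultimately show ?thesis by (metis mult.assoc mult_1)
      qed
      also have "U * exp c' * ((t * ln t powr \<mu>) powr (- (real DIM('a) / \<sigma>)) * K) + exp (- \<delta> * t) * V
          \<le> U * exp c' * ((t * ln t powr \<mu>) powr (- (real DIM('a) / \<sigma>)) * K)
            + (t * ln t powr \<mu>) powr (- (real DIM('a) / \<sigma>)) * V"
        using decay V by (intro add_left_mono mult_right_mono)
      also have "\<dots> \<le> (exp c' * K + 1) * (U + V) * (t * ln t powr \<mu>) powr (- (real DIM('a) / \<sigma>))"
      proof -
        have "0 \<le> (exp c' * K * V + U) * (t * ln t powr \<mu>) powr (- (real DIM('a) / \<sigma>))"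
          using K U V by simp
        then show ?thesis by (simp add: algebra_simps)
      qed
      finally show "(LINT \<xi>|lborel. norm (fourier (solution J u t) \<xi>))
        \<le> (exp c' * K + 1) * ((LINT x|lborel. norm (u x)) + (LINT \<xi>|lborel. norm (fourier u \<xi>)))
            * (t * ln t powr \<mu>) powr (- (real DIM('a) / \<sigma>))"
        by (simp add: U_def V_def)
    qed
  qed
qed

end

section \<open>Interpolation and passage to Borel representatives\<close>

text \<open>
  For finite \<open>p\<close> this is \<open>\<bar>f\<bar>\<^sup>p \<le> (N \<kappa>)\<^bsup>p-1\<^esup> \<bar>f\<bar>\<close>. Writing the sup bound as \<open>N \<kappa>\<close>, with the same \<open>N\<close> as
  in the \<open>L\<^sup>1\<close> bound, makes \<open>N\<close> appear to the first power for every \<open>p\<close> and avoids separate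
  treatment of \<open>N = 0\<close> in the conclusion.
\<close>
lemma L1_Linf_interpolation:
  fixes f :: "'a::euclidean_space \<Rightarrow> complex"
  assumes f: "integrable lebesgue f" and N: "(LINT x|lebesgue. norm (f x)) \<le> N"
    and \<kappa>: "0 < \<kappa>" and bound: "AE x in lebesgue. norm (f x) \<le> N * \<kappa>" and p: "1 \<le> p"
  shows "in_Lp p f" and "Lp_norm p f \<le> N * \<kappa> powr (1 - enn2real (1 / p))"
proof -
  have [measurable]: "f \<in> borel_measurable lebesgue" using f by (rule borel_measurable_integrable)
  have N0: "0 \<le> N" by (rule order_trans[OF _ N]) simp
  have "in_Lp p f \<and> Lp_norm p f \<le> N * \<kappa> powr (1 - enn2real (1 / p))"
  proof (cases "p = \<infinity>")
    case True
    have "esssup lebesgue (\<lambda>x. ennreal (norm (f x))) \<le> ennreal (N * \<kappa>)"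
      using bound by (intro esssup_I) (auto elim!: eventually_mono intro: ennreal_leI)
    moreover from this have "enn2real (esssup lebesgue (\<lambda>x. ennreal (norm (f x)))) \<le> N * \<kappa>"
      using N0 \<kappa> by (intro enn2real_leI) auto
    ultimately show ?thesis
      using True \<kappa> by (auto simp: in_Lp_def Lp_norm_def intro: le_less_trans)
  next
    case False
    define q where "q = enn2real p"
    have pq: "p = ennreal q" using False by (simp add: q_def less_top)
    have q: "1 \<le> q" using p unfolding pq by (simp add: ennreal_ge_1)
    have inv: "enn2real (1 / p) = 1 / q"
      using q divide_ennreal[of 1 q] by (simp add: pq)
    have le: "AE x in lebesgue. norm (f x) powr q \<le> (N * \<kappa>) powr (q - 1) * norm (f x)"
      using bound
    proof eventually_elim
      case (elim x)
      have "norm (f x) powr q = norm (f x) powr (q - 1) * norm (f x)"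
        using powr_add[of "norm (f x)" "q - 1" 1] by (cases "f x = 0") auto
      also have "\<dots> \<le> (N * \<kappa>) powr (q - 1) * norm (f x)"
        using elim q by (intro mult_right_mono powr_mono2) auto
      finally show ?case .
    qed
    have int: "integrable lebesgue (\<lambda>x. norm (f x) powr q)"
    proof (rule Bochner_Integration.integrable_bound)
      show "integrable lebesgue (\<lambda>x. (N * \<kappa>) powr (q - 1) * norm (f x))"
        using f by (intro integrable_mult_right integrable_norm)
    qed (use le in \<open>auto elim!: eventually_mono\<close>)
    have "(LINT x|lebesgue. norm (f x) powr q) \<le> (LINT x|lebesgue. (N * \<kappa>) powr (q - 1) * norm (f x))"
      using f by (intro integral_mono_AE int le integrable_mult_right integrable_norm)
    also have "\<dots> \<le> (N * \<kappa>) powr (q - 1) * N"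
      using N by (simp add: mult_left_mono)
    also have "\<dots> = N powr q * \<kappa> powr (q - 1)"
      using N0 \<kappa> powr_add[of N "q - 1" 1] by (cases "N = 0") (auto simp: powr_mult)
    finally have "(LINT x|lebesgue. norm (f x) powr q) powr (1 / q) \<le> (N powr q * \<kappa> powr (q - 1)) powr (1 / q)"
      using q by (intro powr_mono2) auto
    also have "\<dots> = N * \<kappa> powr (1 - 1 / q)"
      using q N0 \<kappa> by (cases "N = 0") (auto simp: powr_mult powr_powr diff_divide_distrib)
    finally have "(LINT x|lebesgue. norm (f x) powr q) powr (1 / q) \<le> N * \<kappa> powr (1 - 1 / q)" .
    then show ?thesis
      using False int by (simp add: in_Lp_def Lp_norm_def inv flip: q_def)
  qed
  then show "in_Lp p f" and "Lp_norm p f \<le> N * \<kappa> powr (1 - enn2real (1 / p))" by auto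
qed

text \<open>
  Needed because the convolution integrand contains the kernel at \<open>x - y\<close>.
\<close>
lemma AE_lborel_reflect:
  fixes x :: "'a::euclidean_space"
  assumes "AE y in lborel. P y"
  shows "AE y in lborel. P (x - y)"
proof -
  obtain N where N: "N \<in> null_sets lborel" "{y. \<not> P y} \<subseteq> N"
    using assms by (auto simp: eventually_ae_filter)
  have [measurable]: "N \<in> sets borel" using N by auto
  have eq: "(lborel :: 'a measure) = distr lborel borel (\<lambda>y. x - y)"
    using lborel_affine[of "- 1" x] by (simp add: density_1)
  have "AE y in distr lborel borel (\<lambda>y. x - y). y \<notin> N"
    by (subst eq[symmetric]) (rule AE_not_in[OF N(1)])
  then have "AE y in lborel. x - y \<notin> N"
    by (simp add: AE_distr_iff)
  then show ?thesis by (rule eventually_mono) (use N in auto)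
qed

text \<open>
  Completeness of Lebesgue measure: a function almost everywhere equal to a Borel function is measurable.
\<close>
lemma lebesgue_integral_cong_AE:
  fixes f g :: "'a::euclidean_space \<Rightarrow> 'b::euclidean_space"
  assumes "g \<in> borel_measurable borel" and eq: "AE x in lborel. f x = g x"
  shows "f \<in> borel_measurable lebesgue" and "(LINT x|lebesgue. f x) = (LINT x|lebesgue. g x)"
    and "integrable lebesgue f \<longleftrightarrow> integrable lborel g"
proof -
  have g: "g \<in> borel_measurable lebesgue"
    using assms(1) by (simp add: measurable_completion)
  have ae: "AE x in lebesgue. f x = g x" by (rule AE_completion[OF eq])
  show f: "f \<in> borel_measurable lebesgue"
    by (rule borel_measurable_AE[OF g]) (use ae in \<open>auto elim: eventually_mono\<close>)
  show "(LINT x|lebesgue. f x) = (LINT x|lebesgue. g x)"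
    by (rule integral_cong_AE[OF f g ae])
  show "integrable lebesgue f \<longleftrightarrow> integrable lborel g"
    using integrable_cong_AE[OF f g ae] assms(1) by (simp add: integrable_completion)
qed

lemma borel_version_complex:
  fixes u :: "'a::euclidean_space \<Rightarrow> complex"
  assumes u: "integrable lebesgue u"
  obtains v where "v \<in> borel_measurable borel" and "AE x in lborel. u x = v x"
proof -
  have "(\<lambda>x. Re (u x)) \<in> borel_measurable lebesgue" "(\<lambda>x. Im (u x)) \<in> borel_measurable lebesgue"
    using u by (auto dest: borel_measurable_integrable)
  then obtain a b where [measurable]: "a \<in> borel_measurable lborel" "b \<in> borel_measurable lborel"
    and ab: "AE x in lborel. Re (u x) = a x" "AE x in lborel. Im (u x) = b x"
    using completion_ex_borel_measurable_real by blast
  show thesis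
  proof (rule that)
    have [measurable]: "a \<in> borel_measurable borel" "b \<in> borel_measurable borel"
      using \<open>a \<in> borel_measurable lborel\<close> \<open>b \<in> borel_measurable lborel\<close> by simp_all
    show "(\<lambda>x. complex_of_real (a x) + \<i> * complex_of_real (b x)) \<in> borel_measurable borel"
      by measurable
    show "AE x in lborel. u x = complex_of_real (a x) + \<i> * complex_of_real (b x)"
      using ab by eventually_elim (simp add: complex_eq_iff)
  qed
qed

lemma fourier_cong_AE:
  assumes [measurable]: "v \<in> borel_measurable borel" and eq: "AE x in lborel. u x = v x"
  shows "fourier u = fourier v"
proof
  fix \<xi>
  show "fourier u \<xi> = fourier v \<xi>"
    unfolding fourier_def
    by (rule lebesgue_integral_cong_AE(2)) (use eq in \<open>auto elim: eventually_mono\<close>)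
qed

text \<open>
  Convolution forgets null sets completely: the results agree at every point, not only almost everywhere.
\<close>
lemma conv_op_cong_AE:
  assumes [measurable]: "J' \<in> borel_measurable borel" "u' \<in> borel_measurable borel"
    and J: "AE x in lborel. J x = J' x" and u: "AE x in lborel. u x = u' x"
  shows "conv_op J u = conv_op J' u'"
proof
  fix x
  show "conv_op J u x = conv_op J' u' x"
    unfolding conv_op_def
  proof (rule lebesgue_integral_cong_AE(2))
    show "AE y in lborel. J (x - y) *\<^sub>R u y = J' (x - y) *\<^sub>R u' y"
      using AE_lborel_reflect[OF J, of x] u by eventually_elim simp
  qed measurable
qed

text \<open>
  All terms of the series except the zeroth coincide at every point.
\<close>
lemma (in convolution_kernel) solution_AE_eq:
  assumes J': "AE x in lborel. J' x = J x" and u: "integrable lborel u"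
    and u': "AE x in lborel. u' x = u x"
  shows "AE x in lborel. solution J' u' t x = solution J u t x"
proof -
  have [measurable]: "u \<in> borel_measurable borel"
    using u by (auto dest: borel_measurable_integrable)
  have iter: "(conv_op J' ^^ Suc k) u' = (conv_op J ^^ Suc k) u \<and>
      (conv_op J ^^ Suc k) u \<in> borel_measurable borel" for k
  proof (induction k)
    case 0
    then show ?case using conv_op_cong_AE[OF J_measurable _ J' u'] by simp
  next
    case (Suc k)
    then have v: "(conv_op J ^^ Suc k) u \<in> borel_measurable borel" by simp
    have "(conv_op J' ^^ Suc (Suc k)) u' = conv_op J' ((conv_op J ^^ Suc k) u)"
      using Suc by simp
    also have "\<dots> = (conv_op J ^^ Suc (Suc k)) u"
      using conv_op_cong_AE[OF J_measurable v J'] by simp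
    finally show ?case using conv_op_measurable[OF v] by simp
  qed
  have mass: "(LINT y|lebesgue. \<bar>J' y\<bar>) = (LINT y|lebesgue. \<bar>J y\<bar>)"
    by (rule lebesgue_integral_cong_AE(2)) (use J' in \<open>auto elim: eventually_mono\<close>)
  show ?thesis
    using u'
  proof eventually_elim
    case (elim x)
    have "(conv_op J' ^^ k) u' x = (conv_op J ^^ k) u x" for k
      using elim iter by (cases k) auto
    then show ?case by (simp add: solution_def mass)
  qed
qed

section \<open>The decay estimate\<close>

lemma borel_kernel_version:
  fixes J :: "'a::euclidean_space \<Rightarrow> real"
  assumes J: "integrable lebesgue J" and nonneg: "\<And>x. 0 \<le> J x" and one: "(LINT x|lebesgue. \<bar>J x\<bar>) = 1"
  obtains K where "convolution_kernel K" and "AE x in lborel. J x = K x"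
proof -
  obtain g where g: "g \<in> borel_measurable lborel" "AE x in lborel. J x = g x"
    using completion_ex_borel_measurable_real borel_measurable_integrable[OF J] by blast
  have [measurable]: "g \<in> borel_measurable borel" using g(1) by simp
  define K where "K x = max 0 (g x)" for x
  have K [measurable]: "K \<in> borel_measurable borel" unfolding K_def[abs_def] by measurable
  have eq: "AE x in lborel. J x = K x"
    using g(2) by eventually_elim (metis K_def max_def nonneg)
  have "(LINT x|lebesgue. K x) = 1"
    using lebesgue_integral_cong_AE(2)[OF K eq] one nonneg by simp
  then have "(LINT x|lborel. K x) = 1"
    by (simp add: integral_completion)
  moreover have "integrable lborel K"
    using lebesgue_integral_cong_AE(3)[OF K eq] J by simp
  ultimately have "convolution_kernel K"
    by unfold_locales (auto simp: K_def)
  then show thesis using eq by (rule that)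
qed

text \<open>
  The bound by the integral of the transform holds almost everywhere, so the representative may be set
  to 0 where it fails; afterwards it is bounded everywhere.
\<close>
lemma bounded_borel_version:
  fixes u :: "'a::euclidean_space \<Rightarrow> complex"
  assumes u: "integrable lebesgue u" and fu: "integrable lebesgue (fourier u)"
  obtains v where "integrable lborel v" and "AE x in lborel. u x = v x"
    and "\<And>x. norm (v x) \<le> (LINT \<xi>|lborel. norm (fourier v \<xi>))"
    and "integrable lborel (fourier v)" and "fourier u = fourier v"
proof -
  obtain g where [measurable]: "g \<in> borel_measurable borel" and eq: "AE x in lborel. u x = g x"
    using borel_version_complex[OF u] by blast
  have g: "integrable lborel g"
    using lebesgue_integral_cong_AE(3)[OF _ eq] u by simp
  have fg: "fourier u = fourier g"
    by (rule fourier_cong_AE[OF _ eq]) measurable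
  then have ifg: "integrable lborel (fourier g)"
    using fu by (simp add: integrable_completion)
  define B where "B = (LINT \<xi>|lborel. norm (fourier g \<xi>))"
  \<comment> \<open>Truncation changes \<open>g\<close> only on a null set.\<close>
  define v where "v x = (if norm (g x) \<le> B then g x else 0)" for x
  have [measurable]: "v \<in> borel_measurable borel"
    unfolding v_def[abs_def] by measurable
  have gv: "AE x in lborel. g x = v x"
    using norm_le_integral_fourier[OF g ifg] by eventually_elim (simp add: v_def B_def)
  have "fourier g = fourier v"
    by (rule fourier_cong_AE[OF _ gv]) measurable
  moreover have "0 \<le> B" by (simp add: B_def)
  ultimately show thesis
    using eq gv ifg g fg
    by (intro that[of v])
       (auto simp: v_def B_def elim: eventually_elim2 intro: Bochner_Integration.integrable_cong_AE_imp[OF g])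
qed

text \<open>
  Collects the two endpoint estimates. It is used with \<open>\<kappa> = 1\<close> for membership in \<open>L\<^sup>p\<close> and with
  \<open>\<kappa>\<close> the decaying factor for the rate.
\<close>
lemma Lp_solution_le:
  fixes K :: "'a::euclidean_space \<Rightarrow> real"
  assumes K: "convolution_kernel K" and J: "AE x in lborel. J x = K x"
    and v: "integrable lborel v" "\<And>x. norm (v x) \<le> B" "integrable lborel (fourier v)"
    and uv: "AE x in lborel. u x = v x" and t: "0 \<le> t" and \<kappa>: "0 < \<kappa>" and p: "1 \<le> p"
    and N: "(LINT x|lborel. norm (v x)) \<le> N"
    and N\<kappa>: "(LINT \<xi>|lborel. norm (fourier (solution K v t) \<xi>)) \<le> N * \<kappa>"
  shows "in_Lp p (solution J u t)"
    and "Lp_norm p (solution J u t) \<le> N * \<kappa> powr (1 - enn2real (1 / p))"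
proof -
  interpret convolution_kernel K by fact
  have w: "integrable lborel (solution K v t)"
    by (rule integrable_solution[OF v(1,2) t])
  then have [measurable]: "solution K v t \<in> borel_measurable borel"
    by (auto dest: borel_measurable_integrable)
  have eq: "AE x in lborel. solution J u t x = solution K v t x"
    by (rule solution_AE_eq[OF J v(1) uv])
  have int: "integrable lebesgue (solution J u t)"
    using lebesgue_integral_cong_AE(3)[OF _ eq] w by simp
  have "(LINT x|lebesgue. norm (solution J u t x)) = (LINT x|lebesgue. norm (solution K v t x))"
    by (rule lebesgue_integral_cong_AE(2)) (use eq in \<open>auto elim: eventually_mono\<close>)
  also have "\<dots> = (LINT x|lborel. norm (solution K v t x))"
    by (rule integral_completion) measurable
  also have "\<dots> \<le> N"
    using integral_norm_solution_le[OF v(1,2) t] N by (rule order_trans)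
  finally have L1: "(LINT x|lebesgue. norm (solution J u t x)) \<le> N" .
  have "AE x in lborel. norm (solution K v t x) \<le> (LINT \<xi>|lborel. norm (fourier (solution K v t) \<xi>))"
    by (rule norm_le_integral_fourier[OF w fourier_solution_L1(1)[OF v(1,2) t v(3)]])
  then have "AE x in lborel. norm (solution J u t x) \<le> N * \<kappa>"
    using eq by eventually_elim (use N\<kappa> in auto)
  then have Linf: "AE x in lebesgue. norm (solution J u t x) \<le> N * \<kappa>"
    by (rule AE_completion)
  show "in_Lp p (solution J u t)"
    and "Lp_norm p (solution J u t) \<le> N * \<kappa> powr (1 - enn2real (1 / p))"
    by (rule L1_Linf_interpolation[OF int L1 \<kappa> Linf p])+
qed

theorem theorem7:
  fixes J :: "real ^ 'n \<Rightarrow> real" and \<sigma> \<mu> A :: real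
  assumes "\<exists>j :: real \<Rightarrow> real. \<forall>x. J x = j (norm x)"
    and "\<And>x. 0 \<le> J x"
    and "integrable lebesgue J"
    and "(LINT x|lebesgue. \<bar>J x\<bar>) = 1"
    and "0 < \<sigma>" and "\<sigma> \<le> 2" and "0 < A"
    and "(\<lambda>\<xi>. fourier (\<lambda>x. complex_of_real (J x)) \<xi>
              - complex_of_real (1 - A * norm \<xi> powr \<sigma> * ln (1 / norm \<xi>) powr \<mu>))
         \<in> o[at 0](\<lambda>\<xi>. complex_of_real (norm \<xi> powr \<sigma> * ln (1 / norm \<xi>) powr \<mu>))"
  shows "(\<forall>u0 :: real ^ 'n \<Rightarrow> complex. \<forall>p \<ge> 1. \<forall>t > 0.
            integrable lebesgue u0 \<longrightarrow> integrable lebesgue (fourier u0) \<longrightarrow>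
            in_Lp p (solution J u0 t)) \<and>
         (\<exists>C > 0. \<forall>\<^sub>F t in at_top. \<forall>u0 :: real ^ 'n \<Rightarrow> complex. \<forall>p \<ge> 1.
            integrable lebesgue u0 \<longrightarrow> integrable lebesgue (fourier u0) \<longrightarrow>
            Lp_norm p (solution J u0 t)
              \<le> C * ((LINT x|lebesgue. norm (u0 x)) + (LINT \<xi>|lebesgue. norm (fourier u0 \<xi>)))
                  * (t * ln t powr \<mu>) powr (- (real CARD('n) / \<sigma>) * (1 - enn2real (1 / p))))"
proof -
  obtain K where K: "convolution_kernel K" and JK: "AE x in lborel. J x = K x"
    using borel_kernel_version[OF assms(3) assms(2) assms(4)] by blast
  interpret convolution_kernel K by fact
  have FK: "fourier (\<lambda>x. complex_of_real (J x)) = fourier (\<lambda>x. complex_of_real (K x))"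
    by (rule fourier_cong_AE) (use JK in \<open>auto elim: eventually_mono\<close>)
  show ?thesis
  proof (intro conjI allI impI)
    fix u0 :: "real ^ 'n \<Rightarrow> complex" and p :: ennreal and t :: real
    assume p: "1 \<le> p" and t: "0 < t" and u0: "integrable lebesgue u0" "integrable lebesgue (fourier u0)"
    obtain v where v: "integrable lborel v" "AE x in lborel. u0 x = v x"
      "\<And>x. norm (v x) \<le> (LINT \<xi>|lborel. norm (fourier v \<xi>))" "integrable lborel (fourier v)"
      using bounded_borel_version[OF u0] by blast
    show "in_Lp p (solution J u0 t)"
    proof (rule Lp_solution_le(1)[OF K JK v(1,3,4,2) _ zero_less_one p])
      show "(LINT x|lborel. norm (v x)) \<le> (LINT x|lborel. norm (v x)) + (LINT \<xi>|lborel. norm (fourier v \<xi>))"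
        by simp
      have "0 \<le> (LINT x|lborel. norm (v x))" by simp
      moreover have "(LINT \<xi>|lborel. norm (fourier (solution K v t) \<xi>)) \<le> (LINT \<xi>|lborel. norm (fourier v \<xi>))"
        using t by (intro fourier_solution_L1(2)[OF v(1,3) _ v(4)]) simp
      ultimately show "(LINT \<xi>|lborel. norm (fourier (solution K v t) \<xi>))
          \<le> ((LINT x|lborel. norm (v x)) + (LINT \<xi>|lborel. norm (fourier v \<xi>))) * 1"
        unfolding mult_1_right by linarith
    qed (use t in simp)
  next
    obtain C where C: "1 \<le> C" and decay: "\<forall>\<^sub>F t in at_top. \<forall>u B. integrable lborel u \<longrightarrow>
        (\<forall>x. norm (u x) \<le> B) \<longrightarrow> integrable lborel (fourier u) \<longrightarrow>
        (LINT \<xi>|lborel. norm (fourier (solution K u t) \<xi>))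
          \<le> C * ((LINT x|lborel. norm (u x)) + (LINT \<xi>|lborel. norm (fourier u \<xi>)))
              * (t * ln t powr \<mu>) powr (- (real DIM(real ^ 'n) / \<sigma>))"
      by (rule fourier_solution_decay[OF assms(5,7) assms(8)[unfolded FK]], rule that)
    show "\<exists>C > 0. \<forall>\<^sub>F t in at_top. \<forall>u0 :: real ^ 'n \<Rightarrow> complex. \<forall>p \<ge> 1.
            integrable lebesgue u0 \<longrightarrow> integrable lebesgue (fourier u0) \<longrightarrow>
            Lp_norm p (solution J u0 t)
              \<le> C * ((LINT x|lebesgue. norm (u0 x)) + (LINT \<xi>|lebesgue. norm (fourier u0 \<xi>)))
                  * (t * ln t powr \<mu>) powr (- (real CARD('n) / \<sigma>) * (1 - enn2real (1 / p)))"
    proof (intro exI conjI)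
      show "0 < C" using C by simp
      show "\<forall>\<^sub>F t in at_top. \<forall>u0 :: real ^ 'n \<Rightarrow> complex. \<forall>p \<ge> 1.
            integrable lebesgue u0 \<longrightarrow> integrable lebesgue (fourier u0) \<longrightarrow>
            Lp_norm p (solution J u0 t)
              \<le> C * ((LINT x|lebesgue. norm (u0 x)) + (LINT \<xi>|lebesgue. norm (fourier u0 \<xi>)))
                  * (t * ln t powr \<mu>) powr (- (real CARD('n) / \<sigma>) * (1 - enn2real (1 / p)))"
        using decay eventually_gt_at_top[of 1]
      proof (eventually_elim, intro allI impI)
        fix t :: real and u0 :: "real ^ 'n \<Rightarrow> complex" and p :: ennreal
        assume decay: "\<forall>u B. integrable lborel u \<longrightarrow>
            (\<forall>x. norm (u x) \<le> B) \<longrightarrow> integrable lborel (fourier u) \<longrightarrow>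
            (LINT \<xi>|lborel. norm (fourier (solution K u t) \<xi>))
              \<le> C * ((LINT x|lborel. norm (u x)) + (LINT \<xi>|lborel. norm (fourier u \<xi>)))
                  * (t * ln t powr \<mu>) powr (- (real DIM(real ^ 'n) / \<sigma>))"
          and t: "1 < t" and p: "1 \<le> p"
          and u0: "integrable lebesgue u0" "integrable lebesgue (fourier u0)"
        obtain v where v: "integrable lborel v" "AE x in lborel. u0 x = v x"
          "\<And>x. norm (v x) \<le> (LINT \<xi>|lborel. norm (fourier v \<xi>))" "integrable lborel (fourier v)"
          "fourier u0 = fourier v"
          using bounded_borel_version[OF u0] by blast
        have [measurable]: "v \<in> borel_measurable borel"
          using v(1) by (auto dest: borel_measurable_integrable)
        define \<kappa> where "\<kappa> = (t * ln t powr \<mu>) powr (- (real CARD('n) / \<sigma>))"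
        define U where "U = (LINT x|lborel. norm (v x))"
        define V where "V = (LINT \<xi>|lborel. norm (fourier v \<xi>))"
        have \<kappa>: "0 < \<kappa>" using t by (simp add: \<kappa>_def)
        have "U * 1 \<le> (U + V) * C" using C by (intro mult_mono) (auto simp: U_def V_def)
        then have N: "U \<le> C * (U + V)" by (simp add: mult.commute)
        have "(LINT x|lebesgue. norm (u0 x)) = (LINT x|lebesgue. norm (v x))"
          by (rule lebesgue_integral_cong_AE(2)) (use v(2) in \<open>auto elim: eventually_mono\<close>)
        then have U: "(LINT x|lebesgue. norm (u0 x)) = U"
          by (simp add: U_def integral_completion)
        have V: "(LINT \<xi>|lebesgue. norm (fourier u0 \<xi>)) = V"
          by (simp add: V_def v(5) integral_completion)
        have "Lp_norm p (solution J u0 t) \<le> C * (U + V) * \<kappa> powr (1 - enn2real (1 / p))"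
          by (rule Lp_solution_le(2)[OF K JK v(1,3,4,2) _ \<kappa> p])
             (use decay v t N in \<open>auto simp: U_def V_def \<kappa>_def\<close>)
        then show "Lp_norm p (solution J u0 t)
              \<le> C * ((LINT x|lebesgue. norm (u0 x)) + (LINT \<xi>|lebesgue. norm (fourier u0 \<xi>)))
                  * (t * ln t powr \<mu>) powr (- (real CARD('n) / \<sigma>) * (1 - enn2real (1 / p)))"
          by (simp add: U V \<kappa>_def powr_powr)
      qed
    qed
  qed
qed

end
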